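(* Let $K$ be an infinite commutative domain and let $R$ be an associative (not necessarily unital) $K$-algebra on which $K$ acts torsion-freely. Then the following statements are equivalent. (i) $R$ satisfies a circle semigroup identity; (ii) $R$ satisfies a reduced semigroup identity; (iii) $R$ satisfies a reduced binomial identity; (iv) there exist $n\ge 0$ and $\alpha_0,\dots,\alpha_n\in K$ with $\alpha_0\neq 0$ and $\alpha_n\neq 0$ such that $\sum_{i=0}^n \alpha_i y^i x y^{n-i}=0$ for all $x,y\in R$; (v) $R$ satisfies an Engel identity, i.e. there is $n\ge 1$ with $e_n(x,y)=0$ for all $x,y\in R$; (vi) $(R,\circ)$ satisfies a Morse identity, i.e. there is $n\ge1$ with $u_n(x,y)=v_n(x,y)$ for all $x,y\in(R,\circ)$.
   Context: All identities are nontrivial. Let $X=\{x=x_1,y=x_2,x_3,\dots\}$. A semigroup $S$ satisfies an identity $u=v$, where $u\ne v$ are words in the free semigroup on $X$, if $u$ and $v$ take equal values in $S$ under every substitution of elements of $S$ for the variables. The identity is left reduced if the first letters of $u,v$ differ, right reduced if the last letters differ, and reduced if both. $(R,\cdot)$ is the multiplicative semigroup of $R$; $(R,\circ)$ is $R$ with the operation $x\circ y=x+y+xy$. "$R$ satisfies a (reduced) semigroup identity" refers to $(R,\cdot)$; "circle semigroup identity" refers to $(R,\circ)$. A binomial identity is a nontrivial polynomial identity $\alpha_1u_1+\alpha_2u_2=0$ with $u_1,u_2$ monomials (words in $X$) and $\alpha_1,\alpha_2\in K$; it is reduced if the first letters of $u_1,u_2$ differ and the last letters differ. $[a,b]=ab-ba$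 and $e_n=[x,y,\dots,y]$ (left-normed, $y$ repeated $n$ times), i.e. $e_1=[x,y]$, $e_{n+1}=[e_n,y]$. Define $f_1(x,y)=xy$, $g_1(x,y)=yx$, $f_{n+1}=f_n\,x_{n+2}\,g_n$, $g_{n+1}=g_n\,x_{n+2}\,f_n$ (with $f_n,g_n$ in variables $x,y,x_3,\dots,x_{n+1}$); the $n$th Morse identity $u_n(x,y)=v_n(x,y)$ is $f_n=g_n$ with $x_3=\dots=x_{n+1}$ replaced by the empty word (identity). *)

theory Defs
  imports Main
begin

text \<open>Words of the free semigroup on X = {x_1, x_2, ...} are nonempty lists of
variable indices; variable x = x_1 is index 0, y = x_2 is index 1, x_k is index k-1.\<close>

fun eval_word :: "('r \<Rightarrow> 'r \<Rightarrow> 'r) \<Rightarrow> (nat \<Rightarrow> 'r) \<Rightarrow> nat list \<Rightarrow> 'r" where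
  "eval_word op s [] = undefined"
| "eval_word op s (a # w) = foldl (\<lambda>acc i. op acc (s i)) (s a) w"

definition sg_identity :: "('r \<Rightarrow> 'r \<Rightarrow> 'r) \<Rightarrow> nat list \<Rightarrow> nat list \<Rightarrow> bool" where
  "sg_identity op u v \<longleftrightarrow> u \<noteq> [] \<and> v \<noteq> [] \<and> u \<noteq> v \<and>
     (\<forall>s. eval_word op s u = eval_word op s v)"

definition reduced_words :: "nat list \<Rightarrow> nat list \<Rightarrow> bool" where
  "reduced_words u v \<longleftrightarrow> hd u \<noteq> hd v \<and> last u \<noteq> last v"

definition circ :: "'r::ring \<Rightarrow> 'r \<Rightarrow> 'r" where
  "circ a b = a + b + a * b"

definition kalgebra :: "('k::comm_ring_1 \<Rightarrow> 'r::ring \<Rightarrow> 'r) \<Rightarrow> bool" where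
  "kalgebra sm \<longleftrightarrow>
     (\<forall>a x y. sm a (x + y) = sm a x + sm a y) \<and>
     (\<forall>a b x. sm (a + b) x = sm a x + sm b x) \<and>
     (\<forall>a b x. sm (a * b) x = sm a (sm b x)) \<and>
     (\<forall>x. sm 1 x = x) \<and>
     (\<forall>a x y. sm a (x * y) = sm a x * y) \<and>
     (\<forall>a x y. sm a (x * y) = x * sm a y)"

definition torsion_free :: "('k::comm_ring_1 \<Rightarrow> 'r::ring \<Rightarrow> 'r) \<Rightarrow> bool" where
  "torsion_free sm \<longleftrightarrow> (\<forall>a x. a \<noteq> 0 \<longrightarrow> sm a x = 0 \<longrightarrow> x = 0)"

definition sat_circle_sg_identity :: "'r::ring itself \<Rightarrow> bool" where
  "sat_circle_sg_identity _ \<longleftrightarrow> (\<exists>u v. sg_identity (circ :: 'r \<Rightarrow> 'r \<Rightarrow> 'r) u v)"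

definition sat_reduced_sg_identity :: "'r::ring itself \<Rightarrow> bool" where
  "sat_reduced_sg_identity _ \<longleftrightarrow>
     (\<exists>u v. sg_identity ((*) :: 'r \<Rightarrow> 'r \<Rightarrow> 'r) u v \<and> reduced_words u v)"

text \<open>(iii) reduced binomial identity  a1 u1 + a2 u2 = 0, nontrivial as a polynomial.\<close>
definition sat_reduced_binomial_identity :: "('k::comm_ring_1 \<Rightarrow> 'r::ring \<Rightarrow> 'r) \<Rightarrow> bool" where
  "sat_reduced_binomial_identity sm \<longleftrightarrow>
     (\<exists>a1 a2 u1 u2. u1 \<noteq> [] \<and> u2 \<noteq> [] \<and> reduced_words u1 u2 \<and>
        (if u1 = u2 then a1 + a2 \<noteq> 0 else a1 \<noteq> 0 \<or> a2 \<noteq> 0) \<and>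
        (\<forall>s. sm a1 (eval_word (*) s u1) + sm a2 (eval_word (*) s u2) = 0))"

text \<open>y^i x y^(n-i), where y^0 means the factor is omitted (R need not be unital).\<close>
definition yxy :: "'r::ring \<Rightarrow> nat \<Rightarrow> 'r \<Rightarrow> nat \<Rightarrow> 'r" where
  "yxy y i x j = (((\<lambda>z. z * y) ^^ j) (((\<lambda>z. y * z) ^^ i) x))"

definition sat_cond_iv :: "('k::comm_ring_1 \<Rightarrow> 'r::ring \<Rightarrow> 'r) \<Rightarrow> bool" where
  "sat_cond_iv sm \<longleftrightarrow>
     (\<exists>n::nat. \<exists>\<alpha>::nat \<Rightarrow> 'k. \<alpha> 0 \<noteq> 0 \<and> \<alpha> n \<noteq> 0 \<and>
        (\<forall>x y::'r. (\<Sum>i\<le>n. sm (\<alpha> i) (yxy y i x (n - i))) = 0))"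

definition engel :: "nat \<Rightarrow> 'r::ring \<Rightarrow> 'r \<Rightarrow> 'r" where
  "engel n x y = ((\<lambda>z. z * y - y * z) ^^ n) x"

definition sat_engel :: "'r::ring itself \<Rightarrow> bool" where
  "sat_engel _ \<longleftrightarrow> (\<exists>n\<ge>1. \<forall>x y::'r. engel n x y = 0)"

text \<open>Morse words: f_1 = xy, g_1 = yx, f_(n+1) = f_n x_(n+2) g_n, g_(n+1) = g_n x_(n+2) f_n.
  Indices: x = 0, y = 1, x_k = k - 1, so x_(n+2) has index n+1.\<close>
fun morse_fg :: "nat \<Rightarrow> nat list \<times> nat list" where
  "morse_fg 0 = ([], [])"
| "morse_fg (Suc 0) = ([0, 1], [1, 0])"
| "morse_fg (Suc (Suc n)) =
     (let (f, g) = morse_fg (Suc n) in (f @ [Suc (Suc n)] @ g, g @ [Suc (Suc n)] @ f))"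

definition morse_u :: "nat \<Rightarrow> nat list" where
  "morse_u n = filter (\<lambda>i. i < 2) (fst (morse_fg n))"
definition morse_v :: "nat \<Rightarrow> nat list" where
  "morse_v n = filter (\<lambda>i. i < 2) (snd (morse_fg n))"

definition sat_morse_circle :: "'r::ring itself \<Rightarrow> bool" where
  "sat_morse_circle _ \<longleftrightarrow> (\<exists>n\<ge>1. \<forall>x y::'r.
      eval_word circ (\<lambda>i. if i = 0 then x else y) (morse_u n) =
      eval_word circ (\<lambda>i. if i = 0 then x else y) (morse_v n))"

end

theory Submission
  imports Defs "HOL-Computational_Algebra.Polynomial" "HOL-Library.Function_Algebras"
begin

text \<open>The top-degree part of a circle identity is a reduced semigroup identity, and the part of a
  reduced binomial identity linear in one variable has the form (iv). Read (iv) as a homogeneous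
  polynomial in the commuting operators \<open>l\<close>, \<open>r\<close> of left and right multiplication by \<open>y\<close>;
  substituting other polynomials in \<open>y\<close> for \<open>y\<close> then shows that a power of \<open>r - l\<close> vanishes,
  which is the Engel identity.

  The main point is that an Engel identity yields a Morse identity. If the differences \<open>d\<^sub>k\<close> of the
  Morse words in \<open>x\<close>, \<open>y\<close> were all nonzero, choose an ideal \<open>M\<close> maximal among those with
  torsion-free quotient that contain no \<open>d\<^sub>k\<close>. As \<open>d\<^sub>k\<close> in an ideal \<open>E\<close> forces \<open>d\<^bsub>k+n\<^esub>\<close> into \<open>E\<^sup>2\<close>,
  the ideal \<open>M\<close> is prime. A prime Engel algebra is reduced, hence a domain, hence commutative, so
  the commutator \<open>d\<^sub>0 = [x, y]\<close> lies in \<open>M\<close>, a contradiction.\<close>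

subsection \<open>Torsion-free algebras, pure ideals and expansions in a scalar parameter\<close>

locale tf_algebra =
  fixes sm :: "'k::idom \<Rightarrow> 'r::ring \<Rightarrow> 'r"
  assumes inf_K: "infinite (UNIV :: 'k set)"
    and kalgebra: "kalgebra sm"
    and torsion_free: "torsion_free sm"
begin

lemma sm_mult_left: "sm a x * y = sm a (x * y)"
  and sm_mult_right: "x * sm a y = sm a (x * y)"
  using kalgebra unfolding kalgebra_def by metis+

sublocale sm: module sm
  using kalgebra unfolding kalgebra_def by unfold_locales metis+

lemma torsion_freeD: "sm a x = 0 \<Longrightarrow> a \<noteq> 0 \<Longrightarrow> x = 0"
  using torsion_free unfolding torsion_free_def by blast

text \<open>Purity, the last condition, says that the quotient by \<open>W\<close> is again torsion-free.\<close>

definition pure_ideal :: "'r set \<Rightarrow> bool" where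
  "pure_ideal W \<longleftrightarrow> 0 \<in> W \<and> (\<forall>x\<in>W. \<forall>y\<in>W. x + y \<in> W) \<and> (\<forall>a. \<forall>x\<in>W. sm a x \<in> W) \<and>
     (\<forall>r. \<forall>x\<in>W. r * x \<in> W \<and> x * r \<in> W) \<and> (\<forall>a x. a \<noteq> 0 \<longrightarrow> sm a x \<in> W \<longrightarrow> x \<in> W)"

lemma pure_idealD:
  assumes "pure_ideal W"
  shows pure_0: "0 \<in> W"
    and pure_add: "x \<in> W \<Longrightarrow> y \<in> W \<Longrightarrow> x + y \<in> W"
    and pure_sm: "x \<in> W \<Longrightarrow> sm a x \<in> W"
    and pure_mult_left: "x \<in> W \<Longrightarrow> r * x \<in> W"
    and pure_mult_right: "x \<in> W \<Longrightarrow> x * r \<in> W"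
    and pure_cancel: "sm a x \<in> W \<Longrightarrow> a \<noteq> 0 \<Longrightarrow> x \<in> W"
  using assms unfolding pure_ideal_def by blast+

lemma pure_minus: "pure_ideal W \<Longrightarrow> x \<in> W \<Longrightarrow> - x \<in> W"
  using pure_sm[of W x "- 1"] by (simp add: sm.scale_minus_left)

lemma pure_diff: "pure_ideal W \<Longrightarrow> x \<in> W \<Longrightarrow> y \<in> W \<Longrightarrow> x - y \<in> W"
  using pure_add[of W x "- y"] pure_minus[of W y] by simp

lemma pure_sum: "pure_ideal W \<Longrightarrow> (\<And>i. i \<in> A \<Longrightarrow> f i \<in> W) \<Longrightarrow> sum f A \<in> W"
  by (induction A rule: infinite_finite_induct) (auto simp: pure_0 pure_add)

lemma pure_cong: "pure_ideal W \<Longrightarrow> x - y \<in> W \<Longrightarrow> x \<in> W \<longleftrightarrow> y \<in> W"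
  using pure_add[of W "x - y" y] pure_diff[of W x "x - y"] by auto

lemma pure_ideal_zero: "pure_ideal {0}"
  unfolding pure_ideal_def using torsion_freeD by auto

lemma ex_separating_scalar: "\<exists>s :: 'k. \<forall>k<m. s ^ k \<noteq> s ^ m"
proof -
  have "finite (\<Union>k<m. {s. poly (monom (1::'k) k - monom 1 m) s = 0})"
  proof (intro finite_UN_I poly_roots_finite)
    fix k assume "k \<in> {..<m}"
    then show "monom (1::'k) k - monom 1 m \<noteq> 0" by (simp add: monom_eq_iff')
  qed simp
  then obtain s where "s \<notin> (\<Union>k<m. {s. poly (monom (1::'k) k - monom 1 m) s = 0})"
    using inf_K by (metis ex_new_if_finite)
  then show ?thesis by (auto simp: poly_monom)
qed

text \<open>A Vandermonde argument: for a sum f(t) with top degree m+1 and \<open>s\<close>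
  separating powers, f(s t) - s^(m+1) f(t) has no top term. Its other coefficients are those of f
  times nonzero scalars, which purity cancels.\<close>

lemma coeffs_mem:
  assumes W: "pure_ideal W"
  shows "(\<And>t. (\<Sum>k\<le>m. sm (t ^ k) (c k)) \<in> W) \<Longrightarrow> k \<le> m \<Longrightarrow> c k \<in> W"
proof (induction m arbitrary: c k)
  case 0
  from "0.prems"(1)[of 1] "0.prems"(2) show ?case by simp
next
  case (Suc m)
  let ?f = "\<lambda>t. \<Sum>k\<le>Suc m. sm (t ^ k) (c k)"
  obtain s :: 'k where s: "\<forall>k<Suc m. s ^ k \<noteq> s ^ Suc m"
    using ex_separating_scalar by blast
  have eq: "?f (s * t) - sm (s ^ Suc m) (?f t) =
    (\<Sum>k\<le>m. sm (t ^ k) (sm (s ^ k - s ^ Suc m) (c k)))" for t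
    by (simp add: sm.scale_sum_right sm.scale_scale sm.scale_right_distrib sum_subtractf [symmetric] power_mult_distrib
        right_diff_distrib sm.scale_left_diff_distrib sm.scale_right_diff_distrib mult.commute del: power_Suc)
  have "sm (s ^ k - s ^ Suc m) (c k) \<in> W" if "k \<le> m" for k
    using that
  proof (rule Suc.IH[rotated])
    show "(\<Sum>k\<le>m. sm (t ^ k) (sm (s ^ k - s ^ Suc m) (c k))) \<in> W" for t
      unfolding eq[symmetric] by (intro pure_diff[OF W] pure_sm[OF W] Suc.prems(1))
  qed
  then have low: "c k \<in> W" if "k \<le> m" for k
    using that s pure_cancel[OF W] by (metis le_imp_less_Suc right_minus_eq)
  have "?f 1 - (\<Sum>k\<le>m. c k) \<in> W"
    by (intro pure_diff[OF W] pure_sum[OF W] Suc.prems(1) low) auto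
  then have "c (Suc m) \<in> W" by simp
  with low Suc.prems(2) show ?case by (auto simp: le_Suc_eq)
qed

text \<open>Since the coefficients beyond \<open>m\<close> vanish, \<open>c\<close> does not depend
  on the bound \<open>m\<close>, and expansions with different bounds can be added and
  compared.\<close>

definition expands :: "('k \<Rightarrow> 'r) \<Rightarrow> nat \<Rightarrow> (nat \<Rightarrow> 'r) \<Rightarrow> bool" where
  "expands f m c \<longleftrightarrow> (\<forall>k>m. c k = 0) \<and> (\<forall>t. f t = (\<Sum>k\<le>m. sm (t ^ k) (c k)))"

lemma expands_mem:
  assumes "pure_ideal W" "expands f m c" "\<And>t. f t \<in> W"
  shows "c k \<in> W"
  using coeffs_mem[OF assms(1), where m = m and c = c and k = k] assms(2,3) pure_0[OF assms(1)]
  unfolding expands_def by (metis not_le)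

lemma expands_const: "expands (\<lambda>t. a) m (\<lambda>k. if k = 0 then a else 0)"
  unfolding expands_def by (simp add: if_distrib[of "sm _"] cong: if_cong)

lemma expands_mono: "expands f m c \<Longrightarrow> m \<le> m' \<Longrightarrow> expands f m' c"
  unfolding expands_def by (auto intro!: sum.mono_neutral_left simp: not_le[symmetric])

lemma expands_add: "expands f m c \<Longrightarrow> expands g m d \<Longrightarrow> expands (\<lambda>t. f t + g t) m (\<lambda>k. c k + d k)"
  unfolding expands_def by (auto simp: sm.scale_right_distrib sum.distrib)

lemma expands_sm: "expands f m c \<Longrightarrow> expands (\<lambda>t. sm a (f t)) m (\<lambda>k. sm a (c k))"
  unfolding expands_def by (auto simp: sm.scale_sum_right sm.scale_scale mult.commute)

lemma expands_minus: "expands f m c \<Longrightarrow> expands g m d \<Longrightarrow> expands (\<lambda>t. f t - g t) m (\<lambda>k. c k - d k)"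
  unfolding expands_def by (auto simp: sm.scale_right_diff_distrib sum_subtractf)

lemma expands_mult_left: "expands f m c \<Longrightarrow> expands (\<lambda>t. a * f t) m (\<lambda>k. a * c k)"
  unfolding expands_def by (auto simp: sum_distrib_left sm_mult_right)

lemma expands_mult_right: "expands f m c \<Longrightarrow> expands (\<lambda>t. f t * a) m (\<lambda>k. c k * a)"
  unfolding expands_def by (auto simp: sum_distrib_right sm_mult_left)

lemma expands_shift:
  assumes "expands f m c"
  shows "expands (\<lambda>t. sm t (f t)) (Suc m) (\<lambda>k. if k = 0 then 0 else c (k - 1))"
proof -
  have "sm t (f t) = (\<Sum>k\<le>Suc m. sm (t ^ k) (if k = 0 then 0 else c (k - 1)))" for t
    using assms unfolding expands_def
    by (simp add: sum.atMost_Suc_shift sm.scale_sum_right sm.scale_scale del: sum.atMost_Suc)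
  then show ?thesis using assms unfolding expands_def by auto
qed

lemma expands_affine_left:
  assumes "expands f m c"
  shows "expands (\<lambda>t. (a + sm t b) * f t) (Suc m) (\<lambda>k. a * c k + (if k = 0 then 0 else b * c (k - 1)))"
  using expands_add[OF expands_mono[OF expands_mult_left[OF assms, of a], of "Suc m"]
      expands_shift[OF expands_mult_left[OF assms, of b]]]
  by (simp add: algebra_simps sm_mult_left)

lemma expands_affine_right:
  assumes "expands f m c"
  shows "expands (\<lambda>t. f t * (a + sm t b)) (Suc m) (\<lambda>k. c k * a + (if k = 0 then 0 else c (k - 1) * b))"
  using expands_add[OF expands_mono[OF expands_mult_right[OF assms, of a], of "Suc m"]
      expands_shift[OF expands_mult_right[OF assms, of b]]]
  by (simp add: algebra_simps sm_mult_right)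

end

subsection \<open>Polynomials in left and right multiplication\<close>

text \<open>Horner's scheme for the module structure over polynomials in which the variable acts as
  \<open>T\<close>. The scalar action is kept general so that the construction can be iterated,
  first for right and then for left multiplication.\<close>

definition poly_scale :: "('c::comm_ring_1 \<Rightarrow> 'm::ab_group_add \<Rightarrow> 'm) \<Rightarrow> ('m \<Rightarrow> 'm) \<Rightarrow> 'c poly \<Rightarrow> 'm \<Rightarrow> 'm"
  where "poly_scale s T p x = fold_coeffs (\<lambda>a z. s a x + T z) p 0"

locale module_endo = module s for s :: "'c::comm_ring_1 \<Rightarrow> 'm::ab_group_add \<Rightarrow> 'm" +
  fixes T :: "'m \<Rightarrow> 'm"
  assumes T_add: "T (x + y) = T x + T y" and T_scale: "T (s a x) = s a (T x)"
begin

lemma T_0 [simp]: "T 0 = 0"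
  using T_add[of 0 0] by simp

lemma poly_scale_0 [simp]: "poly_scale s T 0 x = 0"
  by (simp add: poly_scale_def)

lemma poly_scale_pCons [simp]: "poly_scale s T (pCons a p) x = s a x + T (poly_scale s T p x)"
  by (cases "a = 0 \<and> p = 0") (auto simp: poly_scale_def)

lemma poly_scale_smult: "poly_scale s T (smult a p) x = s a (poly_scale s T p x)"
  by (induction p) (auto simp: scale_right_distrib T_scale)

lemma module_poly_scale: "module (poly_scale s T)"
proof
  fix p q :: "'c poly" and x y :: 'm
  show "poly_scale s T p (x + y) = poly_scale s T p x + poly_scale s T p y"
    by (induction p) (auto simp: scale_right_distrib T_add)
  show add: "poly_scale s T (p + q) x = poly_scale s T p x + poly_scale s T q x" for p q x
    by (induction p q rule: poly_induct2) (auto simp: scale_left_distrib T_add)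
  show "poly_scale s T p (poly_scale s T q x) = poly_scale s T (p * q) x"
    by (induction p) (auto simp: add poly_scale_smult)
  show "poly_scale s T 1 x = x"
    by (simp add: one_pCons)
qed

lemma poly_scale_commute:
  assumes "\<And>x y. U (x + y) = U x + U y" "\<And>a x. U (s a x) = s a (U x)" "\<And>x. U (T x) = T (U x)"
  shows "U (poly_scale s T p x) = poly_scale s T p (U x)"
proof -
  have "U 0 = 0" using assms(1)[of 0 0] by simp
  then show ?thesis by (induction p) (auto simp: assms)
qed

end

text \<open>The inner variable stands for right multiplication by y, the outer one for left
  multiplication.\<close>

definition cst :: "'k::comm_ring_1 \<Rightarrow> 'k poly poly" where "cst a = [:[:a:]:]"
definition lvar :: "'k::comm_ring_1 poly poly" where "lvar = [:0, 1:]"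
definition rvar :: "'k::comm_ring_1 poly poly" where "rvar = [:[:0, 1:]:]"

lemma cst_mult: "cst (a * b) = cst a * cst b"
  by (simp add: cst_def)

lemma cst_power: "cst a ^ n = cst (a ^ n)"
  by (induction n) (simp_all add: cst_mult, simp add: cst_def one_pCons)

lemma cst_of_nat: "cst (of_nat n) = of_nat n"
  by (simp add: cst_def of_nat_poly)

lemma cst_minus_one: "cst (- 1) = - 1"
  by (simp add: cst_def one_pCons)

lemma power_diff_expand:
  "(rvar - lvar) ^ n =
    (\<Sum>i\<le>n. cst ((- 1) ^ i * of_nat (n choose i)) * (lvar ^ i * rvar ^ (n - i)) :: 'k::comm_ring_1 poly poly)"
proof -
  have "(rvar - lvar) ^ n = (- lvar + rvar :: 'k poly poly) ^ n" by simp
  also have "\<dots> = (\<Sum>i\<le>n. of_nat (n choose i) * (- lvar) ^ i * rvar ^ (n - i))"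
    by (rule binomial_ring)
  also have "\<dots> = (\<Sum>i\<le>n. cst ((- 1) ^ i * of_nat (n choose i)) * (lvar ^ i * rvar ^ (n - i)))"
    by (intro sum.cong refl)
      (simp add: cst_mult cst_of_nat cst_power[symmetric] cst_minus_one power_minus[of lvar] mult_ac)
  finally show ?thesis .
qed

context tf_algebra
begin

definition racts :: "'r \<Rightarrow> 'k poly \<Rightarrow> 'r \<Rightarrow> 'r" where
  "racts y = poly_scale sm (\<lambda>z. z * y)"

definition act :: "'r \<Rightarrow> 'k poly poly \<Rightarrow> 'r \<Rightarrow> 'r" where
  "act y = poly_scale (racts y) (\<lambda>z. y * z)"

lemma module_endo_right: "module_endo sm (\<lambda>z. z * y)"
  by standard (auto simp: distrib_right sm_mult_left)

text \<open>By associativity left and right multiplications commute, so left multiplication is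
  linear over polynomials in right multiplication.\<close>

lemma module_endo_left: "module_endo (racts y) (\<lambda>z. y * z)"
proof -
  interpret r: module_endo sm "\<lambda>z. z * y" by (rule module_endo_right)
  interpret m: module "racts y" unfolding racts_def by (rule r.module_poly_scale)
  show ?thesis
    by standard (auto simp: distrib_left racts_def sm_mult_right mult.assoc intro!: r.poly_scale_commute)
qed

lemma module_act: "module (act y)"
  unfolding act_def by (rule module_endo.module_poly_scale[OF module_endo_left])

lemma act_mult: "act y (p * q) x = act y p (act y q x)"
  using module.scale_scale[OF module_act] by metis

lemma act_one: "act y 1 x = x"
  using module.scale_one[OF module_act] .

lemma act_zero: "act y p 0 = 0"
  using module.scale_zero_right[OF module_act] .

lemma act_sum: "act y (sum p A) x = (\<Sum>i\<in>A. act y (p i) x)"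
  using module.scale_sum_left[OF module_act] .

lemma act_diff: "act y (p - q) x = act y p x - act y q x"
  using module.scale_left_diff_distrib[OF module_act] .

lemma act_add: "act y (p + q) x = act y p x + act y q x"
  using module.scale_left_distrib[OF module_act] .

lemma racts_simps: "racts y 0 x = 0" "racts y (pCons a p) x = sm a x + racts y p x * y"
  unfolding racts_def
  by (rule module_endo.poly_scale_0[OF module_endo_right])
    (rule module_endo.poly_scale_pCons[OF module_endo_right])

lemma act_simps: "act y 0 x = 0" "act y (pCons q p) x = racts y q x + y * act y p x"
  unfolding act_def
  by (rule module_endo.poly_scale_0[OF module_endo_left])
    (rule module_endo.poly_scale_pCons[OF module_endo_left])

lemma act_cst: "act y (cst a) x = sm a x"
  by (simp add: cst_def act_simps racts_simps)

lemma act_lvar: "act y lvar x = y * x"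
  by (simp add: lvar_def act_simps racts_simps one_pCons)

lemma act_rvar: "act y rvar x = x * y"
  by (simp add: rvar_def act_simps racts_simps)

lemma act_power: "act y (p ^ n) x = (act y p ^^ n) x"
  by (induction n) (auto simp: act_one act_mult)

lemma yxy_act:
  assumes "\<And>x. act y p x = z * x" "\<And>x. act y q x = x * z"
  shows "yxy z i x j = act y (p ^ i * q ^ j) x"
proof -
  have "(\<lambda>x. z * x) = act y p" "(\<lambda>x. x * z) = act y q"
    using assms by auto
  then show ?thesis
    unfolding yxy_def by (simp add: act_power[symmetric] act_mult[symmetric] mult.commute)
qed

lemma engel_act: "engel n x y = act y ((rvar - lvar) ^ n) x"
proof -
  have "(\<lambda>z. z * y - y * z) = act y (rvar - lvar)"
    by (auto simp: act_diff act_lvar act_rvar)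
  then show ?thesis unfolding engel_def by (simp only: act_power)
qed

lemma engel_zero: "engel n 0 y = (0::'r)"
  by (simp add: engel_act act_zero)

lemma engel_add: "engel (m + n) x y = engel m (engel n x y) y"
  unfolding engel_def by (simp add: funpow_add)

lemma engel_mono:
  assumes "\<And>x y. engel n x y = (0::'r)" "n \<le> m"
  shows "engel m x y = (0::'r)"
  using engel_add[of "m - n" n x y] assms by (simp add: engel_zero)

section \<open>Condition (iv) and the Engel identity\<close>

lemma engel_imp_iv:
  assumes "sat_engel TYPE('r)"
  shows "sat_cond_iv sm"
proof -
  obtain n where n: "\<And>x y::'r. engel n x y = 0"
    using assms unfolding sat_engel_def by blast
  \<comment> \<open>The outer signed binomial coefficients are 1 and (-1)^n, nonzero in every
    characteristic.\<close>
  let ?\<alpha> = "\<lambda>i. (- 1) ^ i * of_nat (n choose i) :: 'k"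
  have "(\<Sum>i\<le>n. sm (?\<alpha> i) (yxy y i x (n - i))) = engel n x y" for x y
    unfolding engel_act power_diff_expand
    by (simp only: act_sum act_mult[of _ "cst _"] act_cst yxy_act[OF act_lvar act_rvar])
  then show ?thesis
    unfolding sat_cond_iv_def using n by (intro exI[of _ n] exI[of _ ?\<alpha>]) auto
qed

text \<open>If \<open>\<Sum>\<alpha>\<^sub>i l\<^sup>i r\<^bsup>n-i\<^esup>\<close>, with \<open>l\<close>, \<open>r\<close> left and right multiplication by \<open>y\<close>, vanishes
  identically, substitute \<open>y\<^sup>2 + t y\<close> for \<open>y\<close>. All coefficients in \<open>t\<close> vanish, so \<open>t\<close>
  may be replaced by the operators \<open>- l\<close> and \<open>- r\<close>: only the term \<open>i = 0\<close>, respectively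
  \<open>i = n\<close>, survives.\<close>

lemma iv_imp_engel:
  assumes "sat_cond_iv sm"
  shows "sat_engel TYPE('r)"
proof -
  obtain n and \<alpha> :: "nat \<Rightarrow> 'k" where nz: "\<alpha> 0 \<noteq> 0" "\<alpha> n \<noteq> 0"
    and id: "\<And>x y::'r. (\<Sum>i\<le>n. sm (\<alpha> i) (yxy y i x (n - i))) = 0"
    using assms unfolding sat_cond_iv_def by blast
  \<comment> \<open>The substituted identity as a polynomial in t over K[l, r]; for instance
    \<open>[:lvar\<^sup>2, lvar:]\<close> is l^2 + t l.\<close>
  define P where "P = (\<Sum>i\<le>n. [:cst (\<alpha> i):] * ([:lvar\<^sup>2, lvar:] ^ i * [:rvar\<^sup>2, rvar:] ^ (n - i)))"
  have poly_P: "poly P q = (\<Sum>i\<le>n. cst (\<alpha> i) * ((lvar\<^sup>2 + q * lvar) ^ i * (rvar\<^sup>2 + q * rvar) ^ (n - i)))" for q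
    unfolding P_def by (simp add: poly_sum poly_power poly_mult del: mult_pCons_left mult_pCons_right)
  have P_cst: "act y (poly P (cst t)) x = 0" for x y t
  proof -
    have "act y (lvar\<^sup>2 + cst t * lvar) z = (y * y + sm t y) * z" for z
      by (simp only: act_add act_mult power2_eq_square act_lvar act_cst)
        (simp add: distrib_right sm_mult_left mult.assoc)
    moreover have "act y (rvar\<^sup>2 + cst t * rvar) z = z * (y * y + sm t y)" for z
      by (simp only: act_add act_mult power2_eq_square act_rvar act_cst)
        (simp add: distrib_left sm_mult_right mult.assoc)
    ultimately have "yxy (y * y + sm t y) i x j =
        act y ((lvar\<^sup>2 + cst t * lvar) ^ i * (rvar\<^sup>2 + cst t * rvar) ^ j) x" for i j
      by (rule yxy_act)
    then have "act y (poly P (cst t)) x = (\<Sum>i\<le>n. sm (\<alpha> i) (yxy (y * y + sm t y) i x (n - i)))"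
      unfolding poly_P by (simp only: act_sum act_mult[of _ "cst _"] act_cst)
    then show ?thesis by (simp add: id)
  qed
  have "act y (coeff P k) x = 0" for x y k
  proof -
    have "expands (\<lambda>t. act y (poly P (cst t)) x) (degree P) (\<lambda>k. act y (coeff P k) x)"
      unfolding expands_def
    proof (intro conjI allI impI)
      show "act y (coeff P k) x = 0" if "k > degree P" for k
        using that module.scale_zero_left[OF module_act] by (simp add: coeff_eq_0)
      show "act y (poly P (cst t)) x = (\<Sum>k\<le>degree P. sm (t ^ k) (act y (coeff P k) x))" for t
        unfolding poly_altdef cst_power mult.commute[of _ "cst _"] by (simp only: act_sum act_mult act_cst)
    qed
    from expands_mem[OF pure_ideal_zero this] show ?thesis by (simp add: P_cst)
  qed
  \<comment> \<open>Every coefficient of \<open>P\<close> acts as zero, hence so does the value of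
    \<open>P\<close> at any element of K[l, r], not only at scalars.\<close>
  then have P: "act y (poly P q) x = 0" for x y q
    unfolding poly_altdef mult.commute[of _ "q ^ _"] by (simp only: act_sum act_mult act_zero sum.neutral_const)
  have r: "act y (rvar ^ n * (rvar - lvar) ^ n) x = 0" for x y
  proof -
    have "poly P (- lvar) = (\<Sum>i\<le>n. if i = 0 then cst (\<alpha> 0) * (rvar\<^sup>2 - lvar * rvar) ^ n else 0)"
      unfolding poly_P
      by (intro sum.cong refl) (auto simp: power2_eq_square power_0_left)
    also have "\<dots> = cst (\<alpha> 0) * (rvar\<^sup>2 - lvar * rvar) ^ n" by simp
    also have "rvar\<^sup>2 - lvar * rvar = (rvar * (rvar - lvar) :: 'k poly poly)"
      by (simp only: power2_eq_square right_diff_distrib mult.commute)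
    finally have "sm (\<alpha> 0) (act y ((rvar * (rvar - lvar)) ^ n) x) = 0"
      using P[of y "- lvar" x] by (simp only: act_mult act_cst)
    then show ?thesis using torsion_freeD nz by (metis power_mult_distrib)
  qed
  have l: "act y (lvar ^ n * (rvar - lvar) ^ n) x = 0" for x y
  proof -
    have "poly P (- rvar) = (\<Sum>i\<le>n. if i = n then cst (\<alpha> n) * (lvar\<^sup>2 - rvar * lvar) ^ n else 0)"
      unfolding poly_P
      by (intro sum.cong refl) (auto simp: power2_eq_square power_0_left)
    also have "\<dots> = cst (\<alpha> n) * (lvar\<^sup>2 - rvar * lvar) ^ n" by simp
    also have "lvar\<^sup>2 - rvar * lvar = (- 1) * (lvar * (rvar - lvar) :: 'k poly poly)"
      by (simp only: power2_eq_square right_diff_distrib mult.commute) simp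
    also have "(\<dots>) ^ n = (- 1) ^ n * (lvar ^ n * (rvar - lvar) ^ n :: 'k poly poly)"
      by (simp only: power_mult_distrib)
    also have "(- 1 :: 'k poly poly) ^ n = cst ((- 1) ^ n)"
      by (simp add: cst_power[symmetric] cst_minus_one)
    finally have "sm (\<alpha> n) (sm ((- 1) ^ n) (act y (lvar ^ n * (rvar - lvar) ^ n) x)) = 0"
      using P[of y "- rvar" x] by (simp only: act_mult act_cst)
    then show ?thesis using torsion_freeD nz by (metis power_eq_0_iff neg_equal_0_iff_equal one_neq_zero)
  qed
  \<comment> \<open>Split (r - l)^(3n) as (r - l)^(2n) (r - l)^n: each monomial of degree 2n in l, r
    is divisible by l^n or by r^n. The extra 1 keeps the index positive when n = 0.\<close>
  have "engel (3 * n + 1) x y = 0" for x y :: 'r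
  proof -
    have "act y (cst a * (lvar ^ i * rvar ^ (2 * n - i)) * (rvar - lvar) ^ n) x = 0" if "i \<le> 2 * n" for i a
    proof (cases "n \<le> i")
      case True
      then have "lvar ^ i = lvar ^ (i - n) * (lvar ^ n :: 'k poly poly)"
        by (simp flip: power_add)
      then have "cst a * (lvar ^ i * rvar ^ (2 * n - i)) * (rvar - lvar) ^ n =
          (cst a * lvar ^ (i - n) * rvar ^ (2 * n - i)) * (lvar ^ n * (rvar - lvar) ^ n)"
        by (simp only: mult_ac)
      then show ?thesis by (simp only: act_mult[of y "_ * rvar ^ _"] l act_zero)
    next
      case False
      then have "rvar ^ (2 * n - i) = rvar ^ (n - i) * (rvar ^ n :: 'k poly poly)"
        by (simp add: mult_2 flip: power_add)
      then have "cst a * (lvar ^ i * rvar ^ (2 * n - i)) * (rvar - lvar) ^ n =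
          (cst a * lvar ^ i * rvar ^ (n - i)) * (rvar ^ n * (rvar - lvar) ^ n)"
        by (simp only: mult.assoc)
      then show ?thesis by (simp only: act_mult[of y "_ * rvar ^ _"] r act_zero)
    qed
    then have "act y ((rvar - lvar) ^ (2 * n) * (rvar - lvar) ^ n) x = 0"
      unfolding power_diff_expand[of "2 * n"] sum_distrib_right act_sum by (intro sum.neutral) auto
    then have "engel (3 * n) x y = 0"
      unfolding engel_act by (simp flip: power_add)
    then show ?thesis by (simp add: engel_def)
  qed
  then show ?thesis unfolding sat_engel_def by (intro exI[of _ "3 * n + 1"]) auto
qed

end

subsection \<open>Words\<close>

lemma eval_word_snoc: "w \<noteq> [] \<Longrightarrow> eval_word f s (w @ [a]) = f (eval_word f s w) (s a)"
  by (cases w) auto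

lemma eval_word_cong: "(\<And>i. i \<in> set w \<Longrightarrow> s i = s' i) \<Longrightarrow> eval_word f s w = eval_word f s' w"
  by (cases w) (simp_all cong: foldl_cong)

lemma circ_assoc: "circ (circ a b) c = circ a (circ b c)"
  by (simp add: circ_def algebra_simps)

lemma eval_word_append:
  assumes "\<And>a b c. f (f a b) c = f a (f b c)" "u \<noteq> []" "v \<noteq> []"
  shows "eval_word f s (u @ v) = f (eval_word f s u) (eval_word f s v)"
  using assms(3)
proof (induction v rule: rev_induct)
  case (snoc a v)
  show ?case
  proof (cases "v = []")
    case True
    then show ?thesis using assms(2) by (simp add: eval_word_snoc)
  next
    case False
    then show ?thesis
      using assms(1,2) snoc.IH eval_word_snoc[of "u @ v" f s a] by (simp add: eval_word_snoc)
  qed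
qed simp

lemma eval_word_const_length: "u \<noteq> [] \<Longrightarrow> v \<noteq> [] \<Longrightarrow> length u = length v \<Longrightarrow>
    eval_word f (\<lambda>_. a) u = eval_word f (\<lambda>_. a) v"
proof (induction u arbitrary: v rule: rev_induct)
  case (snoc b u)
  then obtain v' c where v: "v = v' @ [c]" by (metis append_butlast_last_id)
  show ?case
  proof (cases "u = []")
    case True
    then show ?thesis using snoc.prems v by simp
  next
    case False
    then have "v' \<noteq> []" using snoc.prems v by auto
    then show ?thesis using snoc.IH[of v'] snoc.prems v False by (simp add: eval_word_snoc)
  qed
qed simp

text \<open>The homogeneous component of degree \<open>k\<close> of \<open>\<Prod>(1 + s\<^sub>i) - 1\<close>, the product running over
  the letters \<open>i\<close> of a word.\<close>

fun circ_coeff :: "(nat \<Rightarrow> 'r::ring) \<Rightarrow> nat list \<Rightarrow> nat \<Rightarrow> 'r" where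
  "circ_coeff s w 0 = 0"
| "circ_coeff s [] (Suc k) = 0"
| "circ_coeff s (a # w) (Suc k) =
     circ_coeff s w (Suc k) + (if k = 0 then s a else s a * circ_coeff s w k)"

lemma circ_coeff_Nil [simp]: "circ_coeff s [] k = 0"
  by (cases k) auto

lemma circ_coeff_snoc: "circ_coeff s (w @ [a]) (Suc k) =
    circ_coeff s w (Suc k) + (if k = 0 then s a else circ_coeff s w k * s a)"
proof (induction w arbitrary: k)
  case (Cons b w)
  then show ?case by (cases k) (auto simp: algebra_simps)
qed (cases k; simp)

lemma circ_coeff_gt_length: "k > length w \<Longrightarrow> circ_coeff s w k = 0"
  by (induction s w k rule: circ_coeff.induct) simp_all

lemma circ_coeff_length: "w \<noteq> [] \<Longrightarrow> circ_coeff s w (length w) = eval_word (*) s w"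
proof (induction w rule: rev_induct)
  case (snoc a w)
  show ?case
  proof (cases "w = []")
    case False
    then show ?thesis
      using snoc.IH by (simp add: circ_coeff_snoc eval_word_snoc circ_coeff_gt_length)
  qed simp
qed simp

text \<open>Formally this cancels the factor 1 + s a. Without a unit in the ring it is done degree
  by degree.\<close>

lemma circ_coeff_Cons_cancel:
  assumes "\<And>k. circ_coeff s (a # u) k = circ_coeff s (a # v) k"
  shows "circ_coeff s u k = circ_coeff s v k"
proof (induction k)
  case (Suc k)
  then show ?case using assms[of "Suc k"] by (simp split: if_splits)
qed simp

lemma circ_coeff_snoc_cancel:
  assumes "\<And>k. circ_coeff s (u @ [a]) k = circ_coeff s (v @ [a]) k"
  shows "circ_coeff s u k = circ_coeff s v k"
proof (induction k)
  case (Suc k)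
  then show ?case using assms[of "Suc k"] by (simp add: circ_coeff_snoc split: if_splits)
qed simp

text \<open>With all variables equal, w = 0 becomes z^m = 0 for m the length of w, and then x^m =
  y^m is a reduced identity.\<close>

lemma sat_reduced_sg_identityI_monomial:
  assumes "w \<noteq> []" "\<And>s. eval_word (*) s w = (0::'r::ring)"
  shows "sat_reduced_sg_identity TYPE('r)"
  unfolding sat_reduced_sg_identity_def
proof (intro exI conjI)
  let ?u = "replicate (length w) (0::nat)" and ?v = "replicate (length w) (1::nat)"
  show "reduced_words ?u ?v" using assms(1) by (simp add: reduced_words_def)
  have "eval_word (*) s (replicate (length w) i) = (0::'r)" for s i
  proof -
    have "eval_word (*) s (replicate (length w) i) = eval_word (*) (\<lambda>_. s i) (replicate (length w) i)"
      by (rule eval_word_cong) simp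
    also have "\<dots> = eval_word (*) (\<lambda>_. s i) w"
      using assms(1) by (intro eval_word_const_length) auto
    finally show ?thesis using assms(2) by simp
  qed
  then show "sg_identity ((*) :: 'r \<Rightarrow> _) ?u ?v"
    unfolding sg_identity_def using assms(1) by (cases "length w") simp_all
qed

text \<open>If the lengths differ, the top component of the longer word vanishes. If they agree,
  common first or last letters are cancelled until both ends differ, and the top components form the
  reduced identity.\<close>

lemma circ_coeff_imp_reduced_sg:
  assumes "u \<noteq> v" "\<And>(s :: nat \<Rightarrow> 'r::ring) k. circ_coeff s u k = circ_coeff s v k"
  shows "sat_reduced_sg_identity TYPE('r)"
  using assms
proof (induction "length u + length v" arbitrary: u v rule: less_induct)
  case less
  have longer: ?case if "length u' < length v'" "\<And>(s :: nat \<Rightarrow> 'r) k. circ_coeff s u' k = circ_coeff s v' k"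
    for u' v'
  proof (rule sat_reduced_sg_identityI_monomial)
    show "v' \<noteq> []" using that(1) by auto
    then show "eval_word (*) s v' = (0::'r)" for s
      using that circ_coeff_gt_length[OF that(1), of s] circ_coeff_length[of v' s] by simp
  qed
  consider "length u < length v" | "length v < length u" | "length u = length v" by linarith
  then show ?case
  proof cases
    case 1
    then show ?thesis by (rule longer) (rule less.prems(2))
  next
    case 2
    then show ?thesis by (rule longer) (rule less.prems(2)[symmetric])
  next
    case 3
    with less.prems have ne: "u \<noteq> []" "v \<noteq> []" by auto
    show ?thesis
    proof (cases "hd u = hd v")
      case True
      then obtain a u' v' where uv: "u = a # u'" "v = a # v'"
        using ne by (metis list.exhaust_sel)
      have "circ_coeff s u' k = circ_coeff s v' k" for s :: "nat \<Rightarrow> 'r" and k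
        using less.prems(2)[of s] unfolding uv by (rule circ_coeff_Cons_cancel)
      then show ?thesis using less.hyps[of u' v'] less.prems(1) uv by simp
    next
      case hd: False
      show ?thesis
      proof (cases "last u = last v")
        case True
        then obtain a u' v' where uv: "u = u' @ [a]" "v = v' @ [a]"
          using ne by (metis append_butlast_last_id)
        have "circ_coeff s u' k = circ_coeff s v' k" for s :: "nat \<Rightarrow> 'r" and k
          using less.prems(2)[of s] unfolding uv by (rule circ_coeff_snoc_cancel)
        then show ?thesis using less.hyps[of u' v'] less.prems(1) uv by simp
      next
        case False
        have "eval_word (*) s u = (eval_word (*) s v :: 'r)" for s
          using less.prems(2)[of s "length u"] circ_coeff_length[OF ne(1), of s]
            circ_coeff_length[OF ne(2), of s] 3 by simp
        then show ?thesis
          unfolding sat_reduced_sg_identity_def sg_identity_def reduced_words_def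
          using ne hd False by blast
      qed
    qed
  qed
qed

section \<open>From circle and binomial identities to condition (iv)\<close>

context tf_algebra
begin

lemma expands_circ: "expands (\<lambda>t. eval_word circ (\<lambda>i. sm t (s i)) (a # w)) (Suc (length w))
    (circ_coeff s (a # w))"
proof (induction w rule: rev_induct)
  case Nil
  have "expands (\<lambda>t. sm t (s a)) 1 (\<lambda>k. if k = 0 then 0 else if k - 1 = 0 then s a else 0)"
    using expands_shift[OF expands_const[of "s a" 0]] by simp
  moreover have "(\<lambda>k. if k = 0 then 0 else if k - 1 = 0 then s a else 0) = circ_coeff s [a]"
  proof
    fix k show "(if k = 0 then 0 else if k - 1 = 0 then s a else 0) = circ_coeff s [a] k"
      by (cases k; cases "k - 1") auto
  qed
  ultimately show ?case by simp
next
  case (snoc b w)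
  let ?E = "\<lambda>w t. eval_word circ (\<lambda>i. sm t (s i)) (a # w)"
  let ?c = "circ_coeff s (a # w)"
  have "expands (\<lambda>t. ?E w t + sm t (s b + ?E w t * s b)) (Suc (Suc (length w)))
    (\<lambda>k. ?c k + (if k = 0 then 0 else (if k - 1 = 0 then s b else 0) + ?c (k - 1) * s b))"
    using expands_add[OF expands_mono[OF snoc] expands_shift[OF expands_add[OF expands_const expands_mult_right[OF snoc]]]]
    by simp
  moreover have "?E (w @ [b]) t = ?E w t + sm t (s b + ?E w t * s b)" for t
    using eval_word_snoc[of "a # w" circ "\<lambda>i. sm t (s i)" b]
    by (simp add: circ_def sm.scale_right_distrib sm_mult_right add.assoc)
  moreover have "(\<lambda>k. ?c k + (if k = 0 then 0 else (if k - 1 = 0 then s b else 0) + ?c (k - 1) * s b)) =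
      circ_coeff s ((a # w) @ [b])"
  proof
    fix k show "?c k + (if k = 0 then 0 else (if k - 1 = 0 then s b else 0) + ?c (k - 1) * s b) =
        circ_coeff s ((a # w) @ [b]) k"
      by (cases k) (simp_all only: circ_coeff_snoc, auto)
  qed
  ultimately show ?case by simp
qed

lemma expands_unique:
  assumes "expands f m c" "expands f n d"
  shows "c k = d k"
proof -
  have "expands (\<lambda>t. f t - f t) (max m n) (\<lambda>k. c k - d k)"
    by (intro expands_minus expands_mono[OF assms(1)] expands_mono[OF assms(2)]) auto
  from expands_mem[OF pure_ideal_zero this] show ?thesis by simp
qed

lemma circle_imp_reduced_sg:
  assumes "sat_circle_sg_identity TYPE('r)"
  shows "sat_reduced_sg_identity TYPE('r)"
proof -
  obtain u v where ne: "u \<noteq> []" "v \<noteq> []" and uv: "u \<noteq> v"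
    and id: "\<And>s :: nat \<Rightarrow> 'r. eval_word circ s u = eval_word circ s v"
    using assms unfolding sat_circle_sg_identity_def sg_identity_def by blast
  obtain a u' b v' where u: "u = a # u'" and v: "v = b # v'" using ne by (metis list.exhaust)
  have "circ_coeff s u k = circ_coeff s v k" for s :: "nat \<Rightarrow> 'r" and k
  proof -
    have "expands (\<lambda>t. eval_word circ (\<lambda>i. sm t (s i)) v) (Suc (length u')) (circ_coeff s u)"
      using expands_circ[of s a u'] by (simp only: u[symmetric] id)
    moreover have "expands (\<lambda>t. eval_word circ (\<lambda>i. sm t (s i)) v) (Suc (length v')) (circ_coeff s v)"
      using expands_circ[of s b v'] by (simp only: v[symmetric])
    ultimately show ?thesis by (rule expands_unique)
  qed
  with uv show ?thesis by (rule circ_coeff_imp_reduced_sg)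
qed

lemma reduced_sg_imp_binomial:
  assumes "sat_reduced_sg_identity TYPE('r)"
  shows "sat_reduced_binomial_identity sm"
proof -
  obtain u v where uv: "u \<noteq> []" "v \<noteq> []" "u \<noteq> v" "reduced_words u v"
    and id: "\<And>s :: nat \<Rightarrow> 'r. eval_word (*) s u = eval_word (*) s v"
    using assms unfolding sat_reduced_sg_identity_def sg_identity_def by blast
  have "sm 1 (eval_word (*) s u) + sm (- 1) (eval_word (*) s v) = 0" for s
    unfolding id[of s] by simp
  then show ?thesis
    unfolding sat_reduced_binomial_identity_def using uv
    by (intro exI[of _ "1 :: 'k"] exI[of _ "- 1 :: 'k"] exI[of _ u] exI[of _ v] conjI allI) auto
qed

lemma eval_word_const_mult: "w \<noteq> [] \<Longrightarrow> eval_word (*) (\<lambda>_. y) w * x = yxy y (length w) x 0"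
proof (induction w arbitrary: x rule: rev_induct)
  case (snoc a w)
  show ?case
  proof (cases "w = []")
    case False
    then have "eval_word (*) (\<lambda>_. y) (w @ [a]) * x = yxy y (length w) (y * x) 0"
      by (simp add: eval_word_snoc mult.assoc snoc.IH[symmetric])
    then show ?thesis by (simp add: yxy_def funpow_swap1)
  qed (simp add: yxy_def)
qed simp

text \<open>Linearization: all letters become y, perturbed in the direction x with a weight
  depending on the letter. The constant term is carried along because the induction on the word
  needs it.\<close>

lemma expands_word:
  assumes "w \<noteq> []"
  shows "\<exists>c. expands (\<lambda>t. eval_word (*) (\<lambda>i. y + sm t (sm (\<gamma> i) x)) w) (length w) c \<and>
    c 0 = eval_word (*) (\<lambda>_. y) w \<and>
    c 1 = (\<Sum>p<length w. sm (\<gamma> (w ! p)) (yxy y p x (length w - 1 - p)))"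
  using assms
proof (induction w rule: rev_induct)
  case (snoc a w)
  let ?f = "\<lambda>w t. eval_word (*) (\<lambda>i. y + sm t (sm (\<gamma> i) x)) w"
  show ?case
  proof (cases "w = []")
    case True
    have "expands (?f [a]) 1 (\<lambda>k. (if k = 0 then y else 0) + (if k = 0 then 0 else if k - 1 = 0 then sm (\<gamma> a) x else 0))"
      using expands_add[OF expands_const[of y "Suc 0"] expands_shift[OF expands_const[of "sm (\<gamma> a) x" 0]]] by simp
    then show ?thesis
      using True
      by (intro exI[of _ "\<lambda>k. (if k = 0 then y else 0) + (if k = 0 then 0 else if k - 1 = 0 then sm (\<gamma> a) x else 0)"])
        (simp add: yxy_def)
  next
    case False
    with snoc obtain c where c: "expands (?f w) (length w) c" "c 0 = eval_word (*) (\<lambda>_. y) w"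
      "c 1 = (\<Sum>p<length w. sm (\<gamma> (w ! p)) (yxy y p x (length w - 1 - p)))" by blast
    let ?d = "\<lambda>k. c k * y + (if k = 0 then 0 else c (k - 1) * sm (\<gamma> a) x)"
    have "expands (?f (w @ [a])) (length (w @ [a])) ?d"
      using expands_affine_right[OF c(1), of y "sm (\<gamma> a) x"] False by (simp add: eval_word_snoc)
    moreover have "?d 0 = eval_word (*) (\<lambda>_. y) (w @ [a])"
      using False c(2) by (simp add: eval_word_snoc)
    moreover have "?d 1 = (\<Sum>p<length (w @ [a]). sm (\<gamma> ((w @ [a]) ! p)) (yxy y p x (length (w @ [a]) - 1 - p)))"
    proof -
      have "c 1 * y = (\<Sum>p<length w. sm (\<gamma> ((w @ [a]) ! p)) (yxy y p x (length w - p)))"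
        unfolding c(3) sum_distrib_right
      proof (intro sum.cong refl)
        fix p assume "p \<in> {..<length w}"
        then have "length w - p = Suc (length w - 1 - p)" "(w @ [a]) ! p = w ! p" by (auto simp: nth_append)
        then show "sm (\<gamma> (w ! p)) (yxy y p x (length w - 1 - p)) * y = sm (\<gamma> ((w @ [a]) ! p)) (yxy y p x (length w - p))"
          by (simp add: sm_mult_left yxy_def)
      qed
      moreover have "c 0 * sm (\<gamma> a) x = sm (\<gamma> a) (yxy y (length w) x 0)"
        unfolding c(2) by (simp add: sm_mult_right eval_word_const_mult False)
      ultimately show ?thesis by simp
    qed
    ultimately show ?thesis by (intro exI[of _ ?d] conjI)
  qed
qed simp

text \<open>Take the part linear in x. Equal lengths make the terms y^p x y^(n-p) of both words
  match, and the conditions on the weights say that the two outer coefficients are nonzero.\<close>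

lemma binomial_imp_iv_aux:
  assumes ne: "u \<noteq> []" "v \<noteq> []" and len: "length u = length v"
    and id: "\<And>s. sm a (eval_word (*) s u) + sm b (eval_word (*) s v) = 0"
    and \<gamma>: "a * \<gamma> (hd u) + b * \<gamma> (hd v) \<noteq> 0" "a * \<gamma> (last u) + b * \<gamma> (last v) \<noteq> 0"
  shows "sat_cond_iv sm"
  unfolding sat_cond_iv_def
proof (intro exI conjI allI)
  let ?n = "length u - 1" and ?\<alpha> = "\<lambda>p. a * \<gamma> (u ! p) + b * \<gamma> (v ! p)"
  show "?\<alpha> 0 \<noteq> 0" using \<gamma>(1) ne by (simp add: hd_conv_nth)
  show "?\<alpha> ?n \<noteq> 0" using \<gamma>(2) ne len by (simp add: last_conv_nth)
  fix x y :: 'r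
  let ?s = "\<lambda>t i. y + sm t (sm (\<gamma> i) x)"
  obtain c where c: "expands (\<lambda>t. eval_word (*) (?s t) u) (length u) c"
    "c 1 = (\<Sum>p<length u. sm (\<gamma> (u ! p)) (yxy y p x (length u - 1 - p)))"
    using expands_word[OF ne(1)] by blast
  obtain d where d: "expands (\<lambda>t. eval_word (*) (?s t) v) (length u) d"
    "d 1 = (\<Sum>p<length u. sm (\<gamma> (v ! p)) (yxy y p x (length u - 1 - p)))"
    using expands_word[OF ne(2), folded len] by blast
  have "sm a (c 1) + sm b (d 1) = 0"
    using expands_mem[OF pure_ideal_zero expands_add[OF expands_sm[OF c(1), of a] expands_sm[OF d(1), of b]]]
      id by simp
  moreover have "{..<length u} = {..?n}" using ne by (auto simp: neq_Nil_conv)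
  ultimately show "(\<Sum>p\<le>?n. sm (?\<alpha> p) (yxy y p x (?n - p))) = 0"
    unfolding c(2) d(2) by (simp add: sm.scale_sum_right sm.scale_scale sm.scale_left_distrib sum.distrib)
qed

lemma eval_word_scale: "w \<noteq> [] \<Longrightarrow>
    eval_word (*) (\<lambda>i. sm t (s i)) w = sm (t ^ length w) (eval_word (*) s w)"
proof (induction w rule: rev_induct)
  case (snoc a w)
  then show ?case
    by (cases "w = []") (auto simp: eval_word_snoc sm_mult_left sm_mult_right sm.scale_scale mult_ac)
qed simp

lemma expands_monomial: "expands (\<lambda>t. sm (t ^ m) a) m (\<lambda>k. if k = m then a else 0)"
proof -
  have "(\<Sum>k\<le>m. sm (t ^ k) (if k = m then a else 0)) = (\<Sum>k\<le>m. if k = m then sm (t ^ m) a else 0)" for t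
    by (intro sum.cong) auto
  then show ?thesis unfolding expands_def by simp
qed

lemma monomial_imp_iv:
  assumes "w \<noteq> []" "\<And>s. eval_word (*) s w = (0::'r)"
  shows "sat_cond_iv sm"
  by (rule binomial_imp_iv_aux[of w w 1 0 "\<lambda>_. 1"]) (use assms in auto)

lemma binomial_imp_iv:
  assumes "sat_reduced_binomial_identity sm"
  shows "sat_cond_iv sm"
proof -
  obtain a b u v where ne: "u \<noteq> []" "v \<noteq> []" and red: "reduced_words u v"
    and nz: "if u = v then a + b \<noteq> 0 else a \<noteq> 0 \<or> b \<noteq> 0"
    and id: "\<And>s. sm a (eval_word (*) s u) + sm b (eval_word (*) s v) = 0"
    using assms unfolding sat_reduced_binomial_identity_def by blast
  have ab: "a \<noteq> 0 \<or> b \<noteq> 0" using nz by (auto split: if_splits)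
  show ?thesis
  proof (cases "length u = length v")
    case len: True
    show ?thesis
    proof (cases "a + b = 0")
      case False
      then show ?thesis using binomial_imp_iv_aux[OF ne len id, of "\<lambda>_. 1"] by simp
    next
      case True
      \<comment> \<open>Constant weights would give only zero coefficients here. Injective weights
        give a multiple of a difference of weights, nonzero at both ends because the words are
        reduced.\<close>
      obtain \<gamma> :: "nat \<Rightarrow> 'k" where \<gamma>: "inj \<gamma>" using infinite_countable_subset[OF inf_K] by blast
      have b: "b = - a" "a \<noteq> 0" using True ab by (auto simp: add_eq_0_iff)
      have "a * \<gamma> i + b * \<gamma> j \<noteq> 0" if "i \<noteq> j" for i j
      proof -
        have "a * \<gamma> i + b * \<gamma> j = a * (\<gamma> i - \<gamma> j)" using b by (simp add: algebra_simps)
        then show ?thesis using that b \<gamma> by (simp add: inj_eq)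
      qed
      then show ?thesis
        using red unfolding reduced_words_def by (intro binomial_imp_iv_aux[OF ne len id, of \<gamma>]) auto
    qed
  next
    case len: False
    \<comment> \<open>Scaling all variables by t separates the two monomials by degree; one with a
      nonzero coefficient must vanish identically.\<close>
    have split: "sm a (eval_word (*) s u) = 0 \<and> sm b (eval_word (*) s v) = 0" for s
    proof -
      let ?m = "max (length u) (length v)"
      let ?A = "sm a (eval_word (*) s u)" and ?B = "sm b (eval_word (*) s v)"
      have "expands (\<lambda>t. sm (t ^ length u) ?A + sm (t ^ length v) ?B) ?m
          (\<lambda>k. (if k = length u then ?A else 0) + (if k = length v then ?B else 0))"
        by (intro expands_add expands_mono[OF expands_monomial]) auto
      moreover have "sm (t ^ length u) ?A + sm (t ^ length v) ?B = 0" for t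
        using id[of "\<lambda>i. sm t (s i)"] ne by (simp add: eval_word_scale sm.scale_scale mult.commute)
      ultimately have "(if k = length u then ?A else 0) + (if k = length v then ?B else 0) = 0" for k
        using expands_mem[OF pure_ideal_zero] by (metis (no_types, lifting) singleton_iff)
      from this[of "length u"] this[of "length v"] len show ?thesis by auto
    qed
    from ab show ?thesis
    proof
      assume "a \<noteq> 0"
      then have "eval_word (*) s u = 0" for s :: "nat \<Rightarrow> 'r" using split[of s] torsion_freeD by blast
      then show ?thesis by (rule monomial_imp_iv[OF ne(1)])
    next
      assume "b \<noteq> 0"
      then have "eval_word (*) s v = 0" for s :: "nat \<Rightarrow> 'r" using split[of s] torsion_freeD by blast
      then show ?thesis by (rule monomial_imp_iv[OF ne(2)])
    qed
  qed
qed

end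

subsection \<open>Prime Engel algebras are commutative\<close>

text \<open>The power a^(m+1), the exponent shifted for lack of a unit.\<close>

definition ppow :: "'r::ring \<Rightarrow> nat \<Rightarrow> 'r" where
  "ppow a m = ((\<lambda>z. z * a) ^^ m) a"

lemma ppow_simps: "ppow a 0 = a" "ppow a (Suc m) = ppow a m * a"
  by (simp_all add: ppow_def)

lemma ppow_commute: "ppow a m * a = a * ppow a m"
  by (induction m) (simp_all add: ppow_simps mult.assoc)

lemma engel_Suc: "engel (Suc k) x y = engel k x y * y - y * engel k x y"
  by (simp add: engel_def)

lemma engel_0: "engel 0 x y = x"
  by (simp add: engel_def)

text \<open>The product (a r)^m a, written without a unit.\<close>

definition zigzag :: "'r::ring \<Rightarrow> 'r \<Rightarrow> nat \<Rightarrow> 'r" where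
  "zigzag a r m = ((\<lambda>z. a * r * z) ^^ m) a"

lemma zigzag_simps: "zigzag a r 0 = a" "zigzag a r (Suc m) = a * r * zigzag a r m"
  by (simp_all add: zigzag_def)

lemma zigzag_mult_right: "zigzag a r m * (r * a) = zigzag a r (Suc m)"
  by (induction m) (simp_all add: zigzag_simps mult.assoc)

lemma funpow_mult_left: "((\<lambda>z. b * z) ^^ m) (x * y) = ((\<lambda>z. b * z) ^^ m) x * (y :: 'r::ring)"
  by (induction m) (simp_all add: mult.assoc)

lemma funpow_distrib: "((\<lambda>z. b * z) ^^ m) (x + y) = ((\<lambda>z. b * z) ^^ m) x + ((\<lambda>z. b * z) ^^ m) (y :: 'r::ring)"
  by (induction m) (simp_all add: distrib_left)

lemma funpow_mult_step: "((\<lambda>z. b * z) ^^ m) (b * x) = ((\<lambda>z. b * z) ^^ Suc m) (x :: 'r::ring)"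
  by (simp add: funpow_swap1)

lemma funpow_zigzag: "((\<lambda>z. a * r * z) ^^ m) (a * x) = zigzag a r m * (x :: 'r::ring)"
  by (simp add: zigzag_def funpow_mult_left)

context tf_algebra
begin

definition prime_mod :: "'r set \<Rightarrow> bool" where
  "prime_mod P \<longleftrightarrow> (\<forall>a b. (\<forall>r. a * r * b \<in> P) \<longrightarrow> a \<in> P \<or> b \<in> P)"

lemmas pure_closed = pure_0 pure_add pure_sm pure_mult_left pure_mult_right pure_minus pure_diff

lemma pure_funpow: "pure_ideal W \<Longrightarrow> x \<in> W \<Longrightarrow> ((\<lambda>z. b * z) ^^ m) x \<in> W"
  by (induction m) (simp_all add: pure_mult_left)

text \<open>Each term of the part linear in t begins with (a r)^i a s. A factor (a r)^N on its left
  makes it begin with (a r)^i (a r)^N a, which lies in \<open>P\<close>.\<close>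

lemma zigzag_linear_part:
  assumes P: "pure_ideal P" and A: "zigzag a r N \<in> P"
  shows "\<exists>c. expands (\<lambda>t. zigzag a (r + sm t s) m) m c \<and> c 0 = zigzag a r m \<and>
    ((\<lambda>z. a * r * z) ^^ N) (c 1) \<in> P"
proof (induction m)
  case 0
  have "((\<lambda>z. a * r * z) ^^ N) 0 = 0" by (induction N) auto
  then show ?case
    using expands_const[of a 0] pure_0[OF P]
    by (intro exI[of _ "\<lambda>k. if k = 0 then a else 0"]) (simp add: zigzag_simps)
next
  case (Suc m)
  then obtain c where c: "expands (\<lambda>t. zigzag a (r + sm t s) m) m c" "c 0 = zigzag a r m"
    "((\<lambda>z. a * r * z) ^^ N) (c 1) \<in> P" by blast
  let ?d = "\<lambda>k. (a * r) * c k + (if k = 0 then 0 else (a * s) * c (k - 1))"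
  have "expands (\<lambda>t. zigzag a (r + sm t s) (Suc m)) (Suc m) ?d"
    using expands_affine_left[OF c(1), of "a * r" "a * s"]
    by (simp add: zigzag_simps distrib_left sm_mult_right)
  moreover have "((\<lambda>z. a * r * z) ^^ N) (?d 1) \<in> P"
  proof -
    have "((\<lambda>z. a * r * z) ^^ N) (?d 1) =
        a * r * ((\<lambda>z. a * r * z) ^^ N) (c 1) + zigzag a r N * (s * c 0)"
      by (simp add: funpow_distrib funpow_mult_step mult.assoc[of a s] funpow_zigzag)
    then show ?thesis using c(3) A pure_closed[OF P] by simp
  qed
  ultimately show ?case using c(2) by (intro exI[of _ ?d]) (simp add: zigzag_simps)
qed

text \<open>The part of \<open>(a (r + t s))\<^bsup>m+1\<^esup> a\<close> linear in \<open>t\<close>, multiplied by \<open>(a r)\<^sup>m\<close> from the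
  left, is \<open>U s U\<close> with \<open>U = (a r)\<^sup>m a\<close>, since \<open>(a r)\<^bsup>m+1\<^esup> a\<close> vanishes.\<close>

lemma zigzag_nil:
  assumes P: "pure_ideal P" "prime_mod P" and nil: "\<And>r. zigzag a r m \<in> P"
  shows "a \<in> P"
  using nil
proof (induction m)
  case 0
  then show ?case by (simp add: zigzag_simps)
next
  case (Suc m)
  show ?case
  proof (rule Suc.IH)
    fix r
    have "zigzag a r m * s * zigzag a r m \<in> P" for s
    proof -
      let ?A = "\<lambda>k. (\<lambda>z. a * r * z) ^^ k"
      obtain c where c: "expands (\<lambda>t. zigzag a (r + sm t s) m) m c" "c 0 = zigzag a r m"
        "?A (Suc m) (c 1) \<in> P" using zigzag_linear_part[OF P(1) Suc.prems] by blast
      have "expands (\<lambda>t. zigzag a (r + sm t s) (Suc m)) (Suc m)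
          (\<lambda>k. (a * r) * c k + (if k = 0 then 0 else (a * s) * c (k - 1)))"
        using expands_affine_left[OF c(1), of "a * r" "a * s"]
        by (simp add: zigzag_simps distrib_left sm_mult_right)
      from expands_mem[OF P(1) this Suc.prems, of 1]
      have "a * r * c 1 + a * s * c 0 \<in> P" by simp
      then have "?A m (a * r * c 1 + a * s * c 0) \<in> P"
        by (rule pure_funpow[OF P(1)])
      moreover have "?A m (a * r * c 1 + a * s * c 0) = ?A (Suc m) (c 1) + zigzag a r m * (s * c 0)"
        by (simp only: funpow_distrib funpow_mult_step mult.assoc[of a s] funpow_zigzag)
      ultimately have "zigzag a r m * (s * c 0) \<in> P"
        using pure_diff[OF P(1) _ c(3)] by (metis add_diff_cancel_left')
      then show ?thesis by (simp add: c(2) mult.assoc)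
    qed
    then show "zigzag a r m \<in> P" using P(2) unfolding prime_mod_def by blast
  qed
qed

text \<open>Modulo \<open>P\<close> left multiplication by r a kills (a r)^k a since a^2 vanishes,
  so each commutator with r a is just right multiplication by r a. The Engel identity thus supplies
  the hypothesis of \<open>zigzag_nil\<close>.\<close>

lemma engel_zigzag:
  assumes P: "pure_ideal P" and a: "a * a \<in> P"
  shows "engel k a (r * a) - zigzag a r k \<in> P"
proof (induction k)
  case 0
  then show ?case by (simp add: engel_0 zigzag_simps pure_0[OF P])
next
  case (Suc k)
  let ?E = "engel k a (r * a)" and ?Z = "zigzag a r k"
  have "r * a * ?Z \<in> P"
  proof (cases k)
    case 0
    then show ?thesis using a pure_mult_left[OF P] by (simp add: zigzag_simps mult.assoc)
  next
    case (Suc j)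
    have "r * (a * a) * (r * zigzag a r j) \<in> P" using a by (blast intro: pure_closed[OF P])
    then show ?thesis using Suc by (simp add: zigzag_simps mult.assoc)
  qed
  then have "(?E - ?Z) * (r * a) - r * a * (?E - ?Z) - r * a * ?Z \<in> P"
    using Suc by (blast intro: pure_closed[OF P])
  moreover have "(?E - ?Z) * (r * a) - r * a * (?E - ?Z) - r * a * ?Z =
      engel (Suc k) a (r * a) - zigzag a r (Suc k)"
    by (simp add: engel_Suc left_diff_distrib right_diff_distrib zigzag_mult_right)
  ultimately show ?case by simp
qed

end

section \<open>Engel algebras modulo a prime ideal\<close>

locale engel_mod_prime = tf_algebra +
  fixes P :: "'b set" and n :: nat
  assumes P: "pure_ideal P" "prime_mod P"
    and engel: "\<And>x y. engel n x y = (0 :: 'b)" and n: "n \<ge> 1"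
begin

lemmas P_simps = pure_closed[OF P(1)]

lemma semiprime: "a * a \<in> P \<Longrightarrow> a \<in> P"
proof (rule zigzag_nil[OF P])
  fix r assume "a * a \<in> P"
  from engel_zigzag[OF P(1) this, of n r] have "- zigzag a r n \<in> P" by (simp add: engel)
  from pure_minus[OF P(1) this] show "zigzag a r n \<in> P" by simp
qed

text \<open>If ab lies in \<open>P\<close>, then b r a has its square in \<open>P\<close>, so b r a
  is in \<open>P\<close> for every r and primeness applies.\<close>

lemma completely_prime:
  assumes "a * b \<in> P"
  shows "a \<in> P \<or> b \<in> P"
proof -
  have "b * r * a \<in> P" for r
  proof (rule semiprime)
    have "b * r * (a * b) * (r * a) \<in> P" using assms by (blast intro: P_simps)
    then show "b * r * a * (b * r * a) \<in> P" by (simp add: mult.assoc)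
  qed
  then show ?thesis using P(2) unfolding prime_mod_def by blast
qed

lemma ppow_mem: "ppow a m \<in> P \<Longrightarrow> a \<in> P"
  by (induction m) (auto simp: ppow_simps dest: completely_prime)

text \<open>The Leibniz rule for the derivation z -> [z, y], cut off after the first derivative of w
  because the second one lies in \<open>P\<close>. At k = 0 the index \<open>k - 1\<close> is
  harmless, its coefficient being 0.\<close>

lemma engel_leibniz:
  assumes "(w * y - y * w) * y - y * (w * y - y * w) \<in> P"
  shows "engel k (z * w) y - (engel k z y * w + sm (of_nat k) (engel (k - 1) z y * (w * y - y * w))) \<in> P"
proof (induction k)
  case 0
  then show ?case by (simp add: engel_0 P_simps)
next
  case (Suc k)
  let ?D = "\<lambda>z. z * y - y * z" and ?c = "w * y - y * w"
  let ?E = "engel k z y" and ?F = "engel (k - 1) z y"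
  let ?d = "engel k (z * w) y - (?E * w + sm (of_nat k) (?F * ?c))"
  have F: "sm (of_nat k) (?D ?F) = sm (of_nat k) ?E"
    by (cases k) (auto simp: engel_Suc)
  have "?D (?F * ?c) = ?D ?F * ?c + ?F * ?D ?c"
    by (simp add: algebra_simps)
  then have "?D (sm (of_nat k) (?F * ?c)) = sm (of_nat k) (?D ?F) * ?c + sm (of_nat k) (?F * ?D ?c)"
    by (simp only: sm_mult_left sm_mult_right sm.scale_right_distrib flip: sm.scale_right_diff_distrib)
  then have s: "?D (sm (of_nat k) (?F * ?c)) = sm (of_nat k) (?E * ?c) + sm (of_nat k) (?F * ?D ?c)"
    unfolding F by (simp only: sm_mult_left)
  have "engel (Suc k) (z * w) y - (engel (Suc k) z y * w + sm (of_nat (Suc k)) (?E * ?c)) =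
      ?D ?d + sm (of_nat k) (?F * ?D ?c)"
  proof -
    have "?D ?d = ?D (engel k (z * w) y) - (?D (?E * w) + ?D (sm (of_nat k) (?F * ?c)))"
      by (simp add: algebra_simps)
    moreover have "?D (?E * w) = ?D ?E * w + ?E * ?c" by (simp add: algebra_simps)
    ultimately show ?thesis unfolding s by (simp add: engel_Suc sm.scale_left_distrib)
  qed
  moreover have "?D ?d + sm (of_nat k) (?F * ?D ?c) \<in> P"
    using Suc assms by (blast intro: P_simps)
  ultimately show ?case by simp
qed

text \<open>With D = [-, y] and c = D w, this is D^(m+1) w^(m+1) = (m+1)! c^(m+1) modulo
  \<open>P\<close>. The second conjunct keeps the induction going.\<close>

lemma engel_ppow:
  assumes c: "(w * y - y * w) * y - y * (w * y - y * w) \<in> P"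
  shows "engel (Suc m) (ppow w m) y - sm (of_nat (fact (Suc m))) (ppow (w * y - y * w) m) \<in> P \<and>
    engel (Suc (Suc m)) (ppow w m) y \<in> P"
proof (induction m)
  case 0
  show ?case using c by (simp add: ppow_simps engel_Suc engel_0 P_simps)
next
  case (Suc m)
  let ?c = "w * y - y * w" and ?W = "ppow w m"
  let ?k = "of_nat (Suc (Suc m)) :: 'a"
  have h: "engel (Suc m) ?W y - sm (of_nat (fact (Suc m))) (ppow ?c m) \<in> P" "engel (Suc (Suc m)) ?W y \<in> P"
    using Suc by auto
  have "engel (Suc (Suc m)) (?W * w) y - (engel (Suc (Suc m)) ?W y * w + sm ?k (engel (Suc m) ?W y * ?c)) \<in> P"
    using engel_leibniz[OF c, of "Suc (Suc m)" ?W] by simp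
  then have "(engel (Suc (Suc m)) (?W * w) y - (engel (Suc (Suc m)) ?W y * w + sm ?k (engel (Suc m) ?W y * ?c)))
      + engel (Suc (Suc m)) ?W y * w
      + sm ?k ((engel (Suc m) ?W y - sm (of_nat (fact (Suc m))) (ppow ?c m)) * ?c) \<in> P"
    using h by (blast intro: P_simps)
  moreover have "sm ?k (sm (of_nat (fact (Suc m))) (ppow ?c m) * ?c) = sm (of_nat (fact (Suc (Suc m)))) (ppow ?c (Suc m))"
    by (simp only: sm_mult_left sm.scale_scale ppow_simps fact_Suc[of "Suc m"] of_nat_mult of_nat_id)
  ultimately have "engel (Suc (Suc m)) (?W * w) y - sm (of_nat (fact (Suc (Suc m)))) (ppow ?c (Suc m)) \<in> P"
    by (simp only: left_diff_distrib sm.scale_right_diff_distrib) simp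
  moreover have "engel (Suc (Suc (Suc m))) (?W * w) y \<in> P"
  proof -
    have "engel (Suc (Suc (Suc m))) ?W y \<in> P"
      using h(2) unfolding engel_Suc[of "Suc (Suc m)"] by (blast intro: P_simps)
    then have "engel (Suc (Suc (Suc m))) ?W y * w + sm (of_nat (Suc (Suc (Suc m)))) (engel (Suc (Suc m)) ?W y * ?c) \<in> P"
      using h(2) by (blast intro: P_simps)
    then show ?thesis
      using engel_leibniz[OF c, of "Suc (Suc (Suc m))" ?W] pure_cong[OF P(1)] by simp
  qed
  ultimately show ?case by (simp only: ppow_simps)
qed

lemma commutator_char_0:
  assumes "CHAR('a) = 0" and c: "(w * y - y * w) * y - y * (w * y - y * w) \<in> P"
  shows "w * y - y * w \<in> P"
proof -
  have "engel (Suc n) (ppow w n) y = 0" by (simp add: engel_Suc engel)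
  then have "- sm (of_nat (fact (Suc n))) (ppow (w * y - y * w) n) \<in> P"
    using engel_ppow[OF c, of n] by simp
  then have "sm (of_nat (fact (Suc n))) (ppow (w * y - y * w) n) \<in> P"
    using pure_minus[OF P(1)] by fastforce
  moreover have "of_nat (fact (Suc n)) \<noteq> (0 :: 'a)"
    using assms(1) by (simp only: of_nat_eq_0_iff_char_dvd) simp
  ultimately show ?thesis using pure_cancel[OF P(1)] ppow_mem by blast
qed

text \<open>In characteristic p the difference r^q - l^q equals (r - l)^q for q = p^n, and this acts
  as zero because q > n. So y^q is central.\<close>

lemma central_ppow:
  assumes "CHAR('a) > 0"
  shows "\<exists>m. \<forall>x y. x * ppow y (Suc m) = ppow y (Suc m) * (x :: 'b)"
proof -
  let ?p = "CHAR('a)"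
  have p: "prime ?p" using assms prime_CHAR_semidom by blast
  have gt: "?p ^ n > n" using p by (intro power_gt_expt) (simp add: prime_gt_Suc_0_nat)
  \<comment> \<open>An exponent of at least 2 leaves a genuine power after one factor is split off,
    as \<open>commutator_char_pos\<close> requires.\<close>
  then have "2 \<le> ?p ^ n" using n by linarith
  then obtain m where "?p ^ n = 2 + m" using le_Suc_ex by blast
  then have m: "?p ^ n = Suc (Suc m)" by simp
  have r: "((rvar - lvar) + lvar :: 'a poly poly) ^ (?p ^ n) = (rvar - lvar) ^ (?p ^ n) + lvar ^ (?p ^ n)"
    by (rule freshmans_dream'[where n = n]) (use p in simp_all)
  have "act y (rvar ^ (?p ^ n)) x = act y (lvar ^ (?p ^ n)) x" for x y
  proof -
    have "act y ((rvar - lvar) ^ (?p ^ n)) x = 0"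
      using engel_mono[OF engel less_imp_le[OF gt]] by (simp add: engel_act)
    then show ?thesis using arg_cong[OF r, of "\<lambda>p. act y p x"] by (simp add: act_add)
  qed
  moreover have "act y (rvar ^ Suc k) x = x * ppow y k" for x y k
    by (induction k arbitrary: x)
      (simp_all add: act_mult act_rvar ppow_simps mult.assoc ppow_commute)
  moreover have "act y (lvar ^ Suc k) x = ppow y k * x" for x y k
    by (induction k arbitrary: x)
      (simp_all add: act_mult act_lvar ppow_simps mult.assoc ppow_commute)
  ultimately show ?thesis unfolding m by metis
qed

text \<open>In positive characteristic some power \<open>z = c\<^bsup>m\<^esup>\<close> of \<open>c = [w, y]\<close> is central, so for
  \<open>e = w c\<^bsup>m-1\<^esup> y\<close> we get \<open>[y, e] = - z y\<close>, and \<open>y\<close> is an eigenvector of \<open>ad e\<close>.\<close>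

lemma commutator_char_pos:
  assumes "CHAR('a) > 0" and cy: "(w * y - y * w) * y - y * (w * y - y * w) \<in> P"
  shows "w * y - y * w \<in> P"
proof -
  obtain m where central: "\<And>x y. x * ppow y (Suc m) = ppow y (Suc m) * (x :: 'b)"
    using central_ppow[OF assms(1)] by blast
  define c where "c = w * y - y * w"
  define g where "g = ppow c m"
  define z where "z = ppow c (Suc m)"
  define e where "e = w * g * y"
  have z: "x * z = z * x" for x unfolding z_def by (rule central)
  have cg: "c * g = z" by (simp add: z_def g_def ppow_simps ppow_commute)
  have "ppow c k * y - y * ppow c k \<in> P" for k
  proof (induction k)
    case (Suc k)
    have "(ppow c k * y - y * ppow c k) * c + ppow c k * (c * y - y * c) \<in> P"
      using Suc cy unfolding c_def[symmetric] by (blast intro: P_simps)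
    then show ?case by (simp add: ppow_simps algebra_simps)
  qed (use cy in \<open>simp add: ppow_simps c_def\<close>)
  then have g: "g * y - y * g \<in> P" unfolding g_def .
  have "y * e - e * y = - (z * y) - w * (g * y - y * g) * y"
    unfolding e_def cg[symmetric] c_def by (simp add: algebra_simps)
  then have ye: "y * e - e * y + z * y \<in> P"
    using g P_simps by simp
  define Z where "Z k = ((\<lambda>u. z * u) ^^ k) y" for k
  have Z_Suc: "Z (Suc k) = z * Z k" for k by (simp add: Z_def)
  have Z_ad: "Z k * e - e * Z k + z * Z k \<in> P" for k
  proof (induction k)
    case 0
    then show ?case using ye by (simp add: Z_def)
  next
    case (Suc k)
    have "e * (z * Z k) = z * (e * Z k)" using z[of e] by (metis mult.assoc)
    then have "Z (Suc k) * e - e * Z (Suc k) + z * Z (Suc k) = z * (Z k * e - e * Z k + z * Z k)"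
      by (simp add: Z_Suc algebra_simps)
    then show ?case using Suc P_simps by simp
  qed
  \<comment> \<open>Since z is central, each commutator with e contributes a factor -z modulo
    \<open>P\<close>. At k = n the Engel identity puts z^n y into \<open>P\<close>.\<close>
  have "engel k y e - sm ((- 1) ^ k) (Z k) \<in> P" for k
  proof (induction k)
    case 0
    then show ?case by (simp add: engel_0 Z_def P_simps)
  next
    case (Suc k)
    let ?d = "engel k y e - sm ((- 1) ^ k) (Z k)"
    have "engel (Suc k) y e - sm ((- 1) ^ Suc k) (Z (Suc k)) =
        ?d * e - e * ?d + sm ((- 1) ^ k) (Z k * e - e * Z k + z * Z k)"
      by (simp add: engel_Suc Z_Suc sm.scale_minus_left sm.scale_right_distrib sm.scale_right_diff_distrib sm_mult_left sm_mult_right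
          left_diff_distrib right_diff_distrib)
    then show ?case using Suc Z_ad P_simps by simp
  qed
  from this[of n] have "- sm ((- 1) ^ n) (Z n) \<in> P" by (simp add: engel)
  then have "sm ((- 1) ^ n) (Z n) \<in> P" using pure_minus[OF P(1)] by fastforce
  then have "Z n \<in> P" using pure_cancel[OF P(1)] by (metis power_eq_0_iff neg_equal_0_iff_equal one_neq_zero)
  moreover have "z \<in> P \<or> y \<in> P" if "Z k \<in> P" for k
    using that by (induction k) (auto simp: Z_def dest: completely_prime)
  ultimately have "z \<in> P \<or> y \<in> P" by blast
  then show ?thesis
  proof
    assume "z \<in> P"
    then show ?thesis using ppow_mem unfolding z_def c_def by blast
  qed (blast intro: P_simps)
qed

text \<open>Descent on the length of the commutator: if [[w, y], y] lies in \<open>P\<close> for w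
  an iterated commutator, then so does [w, y].\<close>

lemma commutator_mem: "x * y - y * x \<in> P"
proof -
  have "engel (Suc k) x y \<in> P \<Longrightarrow> engel (Suc 0) x y \<in> P" for k
  proof (induction k)
    case (Suc k)
    let ?w = "engel k x y"
    have "(?w * y - y * ?w) * y - y * (?w * y - y * ?w) \<in> P"
      using Suc.prems by (simp add: engel_Suc)
    then have "?w * y - y * ?w \<in> P"
      using commutator_char_0 commutator_char_pos by blast
    then show ?case using Suc.IH by (simp add: engel_Suc)
  qed simp
  moreover have "engel (Suc n) x y \<in> P" by (simp add: engel_Suc engel P_simps)
  ultimately show ?thesis by (simp add: engel_Suc engel_0)
qed

end

subsection \<open>Morse identities\<close>

text \<open>Index k gives the values of the Morse words number k+1.\<close>

primrec morse_pair :: "'r::ring \<Rightarrow> 'r \<Rightarrow> nat \<Rightarrow> 'r \<times> 'r" where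
  "morse_pair x y 0 = (circ x y, circ y x)"
| "morse_pair x y (Suc k) =
     (circ (fst (morse_pair x y k)) (snd (morse_pair x y k)),
      circ (snd (morse_pair x y k)) (fst (morse_pair x y k)))"

lemma engel_Suc': "engel (Suc k) z u = engel k (z * u - u * z) u"
  unfolding engel_def using funpow_swap1[of "\<lambda>z. z * u - u * z" k z] by simp

text \<open>Commutation with w and commutation with u are commuting maps when w and u
  commute.\<close>

lemma engel_commute:
  assumes "w * u = u * w"
  shows "engel k (z * w - w * z) u = engel k z u * w - w * engel k z u"
proof (induction k)
  case (Suc k)
  let ?e = "engel k z u"
  have "?e * w * u = ?e * u * w" "u * (w * ?e) = w * (u * ?e)"
    using assms by (metis mult.assoc)+
  then show ?case
    unfolding engel_Suc Suc by (simp add: algebra_simps)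
qed (simp add: engel_0)

context tf_algebra
begin

lemma pure_engel: "pure_ideal W \<Longrightarrow> z \<in> W \<Longrightarrow> engel k z y \<in> W"
  by (induction k) (auto simp: engel_0 engel_Suc pure_closed)

lemma pure_Int: "pure_ideal A \<Longrightarrow> pure_ideal B \<Longrightarrow> pure_ideal (A \<inter> B)"
  unfolding pure_ideal_def by blast

lemma pure_Union_chain:
  assumes "\<C> \<noteq> {}" "subset.chain {P. pure_ideal P \<and> Q P} \<C>"
  shows "pure_ideal (\<Union>\<C>)"
proof -
  have P: "pure_ideal X" if "X \<in> \<C>" for X
    using assms(2) that unfolding subset.chain_def by auto
  define U where "U = \<Union>\<C>"
  have add: "x + y \<in> U" if "x \<in> U" "y \<in> U" for x y
  proof -
    from that obtain X Y where XY: "X \<in> \<C>" "x \<in> X" "Y \<in> \<C>" "y \<in> Y" unfolding U_def by blast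
    then have "X \<subseteq> Y \<or> Y \<subseteq> X" using assms(2) unfolding subset.chain_def by blast
    then show ?thesis using XY P pure_add unfolding U_def by blast
  qed
  have zero: "0 \<in> U" using assms(1) P pure_0 unfolding U_def by blast
  have ops: "sm a x \<in> U \<and> r * x \<in> U \<and> x * r \<in> U" if "x \<in> U" for a r x
    using that P unfolding U_def by (blast intro: pure_sm pure_mult_left pure_mult_right)
  have cancel: "x \<in> U" if "sm a x \<in> U" "a \<noteq> 0" for a x
    using that P pure_cancel unfolding U_def by (metis UnionE UnionI)
  have "pure_ideal U"
    unfolding pure_ideal_def
    by (intro conjI ballI allI impI) (simp_all add: add zero ops, erule cancel, assumption)
  then show ?thesis unfolding U_def .
qed

text \<open>If a is not in \<open>M\<close>, then \<open>A\<close>, the x with x R b inside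
  \<open>M\<close>, is strictly larger, which forces \<open>B = M\<close>. As R b lies in
  \<open>B\<close>, b is in \<open>Z\<close>; and \<open>Z\<close> has all its products in
  \<open>M\<close>, so it cannot be strictly larger than \<open>M\<close>.\<close>

lemma prime_modI:
  assumes M: "pure_ideal M"
    and prod: "\<And>A B. pure_ideal A \<Longrightarrow> pure_ideal B \<Longrightarrow> M \<subset> A \<Longrightarrow> M \<subset> B \<Longrightarrow> \<exists>x\<in>A. \<exists>z\<in>B. x * z \<notin> M"
  shows "prime_mod M"
  unfolding prime_mod_def
proof (intro allI impI)
  fix a b assume ab: "\<forall>r. a * r * b \<in> M"
  define A where "A = {x. \<forall>r. x * r * b \<in> M}"
  define B where "B = {z. \<forall>x\<in>A. x * z \<in> M}"
  define Z where "Z = {z. \<forall>r. r * z \<in> M}"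
  have A: "pure_ideal A"
    unfolding pure_ideal_def
  proof (intro conjI ballI allI impI)
    fix x r assume x: "x \<in> A"
    show "r * x \<in> A"
      using x pure_mult_left[OF M] unfolding A_def by (simp add: mult.assoc)
    have "x * (r * s) * b \<in> M" for s using x unfolding A_def by blast
    then show "x * r \<in> A" unfolding A_def by (simp add: mult.assoc)
  next
    fix k x assume "k \<noteq> 0" "sm k x \<in> A"
    then show "x \<in> A" using pure_cancel[OF M] unfolding A_def by (fastforce simp: sm_mult_left)
  qed (auto simp: A_def distrib_right sm_mult_left pure_closed[OF M])
  have B: "pure_ideal B"
    unfolding pure_ideal_def
  proof (intro conjI ballI allI impI)
    fix z r assume z: "z \<in> B"
    show "z * r \<in> B"
      using z pure_mult_right[OF M] unfolding B_def by (simp flip: mult.assoc)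
    have "x * r * z \<in> M" if "x \<in> A" for x
      using z pure_mult_right[OF A that] unfolding B_def by blast
    then show "r * z \<in> B" unfolding B_def by (simp add: mult.assoc)
  next
    fix k x assume "k \<noteq> 0" "sm k x \<in> B"
    then show "x \<in> B" using pure_cancel[OF M] unfolding B_def by (fastforce simp: sm_mult_right)
  qed (auto simp: B_def distrib_left sm_mult_right pure_closed[OF M])
  have Z: "pure_ideal Z"
    unfolding pure_ideal_def
  proof (intro conjI ballI allI impI)
    fix z r assume z: "z \<in> Z"
    show "z * r \<in> Z"
      using z pure_mult_right[OF M] unfolding Z_def by (simp flip: mult.assoc)
    have "s * r * z \<in> M" for s using z unfolding Z_def by blast
    then show "r * z \<in> Z" unfolding Z_def by (simp add: mult.assoc)
  next
    fix k x assume "k \<noteq> 0" "sm k x \<in> Z"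
    then show "x \<in> Z" using pure_cancel[OF M] unfolding Z_def by (fastforce simp: sm_mult_right)
  qed (auto simp: Z_def distrib_left sm_mult_right pure_closed[OF M])
  have sub: "M \<subseteq> A" "M \<subseteq> B" "M \<subseteq> Z"
    unfolding A_def B_def Z_def using pure_mult_left[OF M] pure_mult_right[OF M] by auto
  show "a \<in> M \<or> b \<in> M"
  proof (rule ccontr)
    assume "\<not> (a \<in> M \<or> b \<in> M)"
    then have a: "a \<notin> M" and b: "b \<notin> M" by auto
    have "a \<in> A" using ab unfolding A_def by blast
    then have "M \<subset> A" using a sub by blast
    moreover have "x * z \<in> M" if "x \<in> A" "z \<in> B" for x z using that unfolding B_def by blast
    ultimately have "B = M" using prod[OF A B] sub by blast
    have "r * b \<in> B" for r unfolding B_def A_def by (simp flip: mult.assoc)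
    then have "b \<in> Z" unfolding Z_def \<open>B = M\<close> by blast
    then have "M \<subset> Z" using b sub by blast
    then obtain x z where "x \<in> Z" "z \<in> Z" "x * z \<notin> M" using prod[OF Z Z] by blast
    then show False unfolding Z_def by blast
  qed
qed

text \<open>Write \<open>d\<^sub>k\<close> for the difference of the two Morse words, so that \<open>d\<^bsub>k+1\<^esub> = [d\<^sub>k, u\<^sub>k]\<close>.
  Modulo an ideal \<open>E\<close> that contains \<open>d\<^sub>k\<close>, both words with larger index are polynomials in
  \<open>u\<^sub>k\<close>. If moreover \<open>E\<^sup>2 \<subseteq> M\<close>, then passing from \<open>d\<^bsub>k+j\<^esub>\<close> to \<open>d\<^bsub>k+j+1\<^esub>\<close> amounts modulo
  \<open>M\<close> to an application of \<open>ad u\<^sub>k\<close>, and the Engel identity puts \<open>d\<^bsub>k+n\<^esub>\<close> into \<open>M\<close>.\<close>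

lemma morse_pair_descent:
  fixes x y :: 'r
  defines "u \<equiv> \<lambda>k. fst (morse_pair x y k)" and "v \<equiv> \<lambda>k. snd (morse_pair x y k)"
  assumes engel: "\<And>x y. engel n x y = (0 :: 'r)"
    and M: "pure_ideal M" and E: "pure_ideal E" and sub: "M \<subseteq> E"
    and EE: "\<And>e f. e \<in> E \<Longrightarrow> f \<in> E \<Longrightarrow> e * f \<in> M"
    and K: "u K - v K \<in> E"
  shows "u (K + n) - v (K + n) \<in> M"
proof -
  have u_Suc: "u (Suc k) = circ (u k) (v k)" and v_Suc: "v (Suc k) = circ (v k) (u k)" for k
    unfolding u_def v_def by simp_all
  have d_Suc: "u (Suc k) - v (Suc k) = (u k - v k) * u k - u k * (u k - v k)" for k
    unfolding u_Suc v_Suc circ_def by (simp add: algebra_simps)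
  have dE: "u (K + j) - v (K + j) \<in> E" for j
  proof (induction j)
    case (Suc j)
    then have "(u (K + j) - v (K + j)) * u (K + j) - u (K + j) * (u (K + j) - v (K + j)) \<in> E"
      by (blast intro: pure_closed[OF E])
    then show ?case by (simp add: d_Suc)
  qed (simp add: K)
  \<comment> \<open>\<open>w\<close> is a polynomial in u_K, obtained by iterating w -> 2w + w^2
    from u_K. The last clause turns commutation with w into commutation of another element of
    \<open>E\<close> with u_K, by [e, w^2] = [e w + w e, w].\<close>
  have w: "\<exists>w. u (K + j) - w \<in> E \<and> w * u K = u K * w \<and>
      (\<forall>e\<in>E. \<exists>e'\<in>E. e * w - w * e = e' * u K - u K * e')" for j
  proof (induction j)
    case 0
    show ?case by (rule exI[of _ "u K"]) (auto simp: pure_closed[OF E])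
  next
    case (Suc j)
    then obtain w where w: "u (K + j) - w \<in> E" "w * u K = u K * w"
      "\<And>e. e \<in> E \<Longrightarrow> \<exists>e'\<in>E. e * w - w * e = e' * u K - u K * e'" by blast
    let ?w = "w + w + w * w" and ?f = "u (K + j) - w" and ?d = "u (K + j) - v (K + j)"
    have "u (K + Suc j) - ?w = ?f + ?f + (w * ?f + ?f * u (K + j)) - (?d + u (K + j) * ?d)"
      by (simp add: u_Suc circ_def algebra_simps)
    moreover have "?f + ?f + (w * ?f + ?f * u (K + j)) - (?d + u (K + j) * ?d) \<in> E"
      using w(1) dE[of j] by (blast intro: pure_closed[OF E])
    ultimately have "u (K + Suc j) - ?w \<in> E" by (simp only:)
    moreover have "?w * u K = u K * ?w"
    proof -
      have "w * w * u K = u K * (w * w)" using w(2) by (metis mult.assoc)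
      then show ?thesis using w(2) by (simp add: distrib_left distrib_right)
    qed
    moreover have "\<exists>e'\<in>E. e * ?w - ?w * e = e' * u K - u K * e'" if "e \<in> E" for e
    proof -
      let ?e = "e + e + (e * w + w * e)"
      have "?e \<in> E" using that by (blast intro: pure_closed[OF E])
      from w(3)[OF this] obtain e' where "e' \<in> E" "?e * w - w * ?e = e' * u K - u K * e'" by blast
      moreover have "e * ?w - ?w * e = ?e * w - w * ?e" by (simp add: algebra_simps)
      ultimately show ?thesis by auto
    qed
    ultimately show ?case by (intro exI[of _ ?w] conjI ballI)
  qed
  have "\<exists>e\<in>E. (u (K + j) - v (K + j)) - engel j e (u K) \<in> M" for j
  proof (induction j)
    case 0
    then show ?case using K pure_0[OF M] by (intro bexI[of _ "u K - v K"]) (simp_all add: engel_0)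
  next
    case (Suc j)
    let ?d = "u (K + j) - v (K + j)" and ?U = "u (K + j)"
    from Suc obtain e where e: "e \<in> E" "?d - engel j e (u K) \<in> M" by blast
    obtain w where w: "?U - w \<in> E" "w * u K = u K * w"
      "\<And>e. e \<in> E \<Longrightarrow> \<exists>e'\<in>E. e * w - w * e = e' * u K - u K * e'" using w[of j] by blast
    from w(3)[OF e(1)] obtain e' where e': "e' \<in> E" "e * w - w * e = e' * u K - u K * e'" by blast
    let ?D = "engel j e (u K)"
    have D: "?D \<in> E" using e(1) by (rule pure_engel[OF E])
    have "engel (Suc j) e' (u K) = ?D * w - w * ?D"
      unfolding engel_Suc' e'(2)[symmetric] by (rule engel_commute[OF w(2)])
    \<comment> \<open>The error has two parts: commutators of an element of \<open>M\<close>, and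
      products of two elements of \<open>E\<close>.\<close>
    then have "(u (K + Suc j) - v (K + Suc j)) - engel (Suc j) e' (u K) =
        ((?d - ?D) * ?U - ?U * (?d - ?D)) + (?D * (?U - w) - (?U - w) * ?D)"
      by (simp add: d_Suc) (simp add: algebra_simps)
    moreover have "((?d - ?D) * ?U - ?U * (?d - ?D)) + (?D * (?U - w) - (?U - w) * ?D) \<in> M"
    proof (rule pure_add[OF M])
      show "(?d - ?D) * ?U - ?U * (?d - ?D) \<in> M"
        using e(2) by (blast intro: pure_closed[OF M])
      show "?D * (?U - w) - (?U - w) * ?D \<in> M"
        using EE D w(1) by (blast intro: pure_diff[OF M])
    qed
    ultimately show ?case using e'(1) by (intro bexI[of _ e']) (simp only:)
  qed
  from this[of n] show ?thesis by (simp add: engel)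
qed

lemma ex_morse_pair_eq:
  fixes x y :: 'r
  assumes engel: "\<And>x y. engel n x y = (0 :: 'r)" and n: "n \<ge> 1"
  shows "\<exists>k. fst (morse_pair x y k) = snd (morse_pair x y k)"
proof (rule ccontr)
  define d where "d k = fst (morse_pair x y k) - snd (morse_pair x y k)" for k
  assume "\<nexists>k. fst (morse_pair x y k) = snd (morse_pair x y k)"
  then have d: "d k \<noteq> 0" for k by (simp add: d_def)
  have d_Suc: "d (Suc k) = d k * fst (morse_pair x y k) - fst (morse_pair x y k) * d k" for k
    by (simp add: d_def circ_def algebra_simps)
  have d_mono: "d l \<in> A" if "pure_ideal A" "d k \<in> A" "k \<le> l" for A k l
    using that(3,2)
  proof (induction l rule: dec_induct)
    case (step m)
    then show ?case unfolding d_Suc using that(1) by (blast intro: pure_closed)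
  qed
  let ?\<A> = "{P. pure_ideal P \<and> (\<forall>k. d k \<notin> P)}"
  have "\<exists>M\<in>?\<A>. \<forall>X\<in>?\<A>. M \<subseteq> X \<longrightarrow> X = M"
  proof (rule subset_Zorn_nonempty)
    show "?\<A> \<noteq> {}" using pure_ideal_zero d by blast
    fix \<C> assume \<C>: "\<C> \<noteq> {}" "subset.chain ?\<A> \<C>"
    then have "pure_ideal (\<Union>\<C>)" by (rule pure_Union_chain)
    moreover have "d k \<notin> \<Union>\<C>" for k using \<C>(2) unfolding subset.chain_def by blast
    ultimately show "\<Union>\<C> \<in> ?\<A>" by blast
  qed
  then obtain M where "M \<in> ?\<A>" and maximal: "\<forall>X\<in>?\<A>. M \<subseteq> X \<longrightarrow> X = M" by (rule bexE)
  then have M: "pure_ideal M" "\<And>k. d k \<notin> M" by auto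
  have max: "\<exists>k. d k \<in> X" if "pure_ideal X" "M \<subset> X" for X
  proof (rule ccontr)
    assume "\<nexists>k. d k \<in> X"
    then have "X \<in> ?\<A>" using that(1) by simp
    then show False using maximal that(2) by blast
  qed
  have "prime_mod M"
  proof (rule prime_modI[OF M(1)], rule ccontr)
    fix A B
    assume AB: "pure_ideal A" "pure_ideal B" "M \<subset> A" "M \<subset> B"
      and "\<not> (\<exists>x\<in>A. \<exists>z\<in>B. x * z \<notin> M)"
    \<comment> \<open>The intersection serves as the single ideal with square inside
      \<open>M\<close> that the descent needs.\<close>
    then have prod: "x * z \<in> M" if "x \<in> A \<inter> B" "z \<in> A \<inter> B" for x z using that by blast
    obtain k l where "d k \<in> A" "d l \<in> B" using max[OF AB(1,3)] max[OF AB(2,4)] by blast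
    \<comment> \<open>Once a difference is in an ideal, all later ones are, so a common index serves
      for both ideals.\<close>
    then have "d (max k l) \<in> A \<inter> B"
      using d_mono[OF AB(1), of k "max k l"] d_mono[OF AB(2), of l "max k l"] by simp
    then have "d (max k l + n) \<in> M"
      unfolding d_def
      by (intro morse_pair_descent[OF engel M(1) pure_Int[OF AB(1,2)] _ prod]) (use AB in auto)
    then show False using M(2) by blast
  qed
  then interpret engel_mod_prime sm M n
    by unfold_locales (use M(1) engel n in auto)
  have "d 0 = x * y - y * x" by (simp add: d_def circ_def)
  then show False using commutator_mem[of x y] M(2)[of 0] by simp
qed

end

section \<open>Function algebras and uniform Morse identities\<close>

definition fun_sm :: "('k \<Rightarrow> 'r \<Rightarrow> 'r) \<Rightarrow> 'k \<Rightarrow> ('p \<Rightarrow> 'r) \<Rightarrow> 'p \<Rightarrow> 'r" where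
  "fun_sm sm a f = (\<lambda>p. sm a (f p))"

lemma (in tf_algebra) tf_algebra_fun: "tf_algebra (fun_sm sm :: 'k \<Rightarrow> ('p \<Rightarrow> 'r) \<Rightarrow> 'p \<Rightarrow> 'r)"
proof
  show "kalgebra (fun_sm sm :: 'k \<Rightarrow> ('p \<Rightarrow> 'r) \<Rightarrow> 'p \<Rightarrow> 'r)"
    unfolding kalgebra_def fun_sm_def
    by (intro conjI allI ext)
      (simp_all add: sm.scale_left_distrib sm.scale_right_distrib sm.scale_scale sm_mult_left sm_mult_right)
  show "torsion_free (fun_sm sm :: 'k \<Rightarrow> ('p \<Rightarrow> 'r) \<Rightarrow> 'p \<Rightarrow> 'r)"
    unfolding torsion_free_def fun_sm_def fun_eq_iff using torsion_freeD by auto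
qed (rule inf_K)

lemma engel_fun: "engel k f g p = engel k (f p) (g p)"
  by (induction k) (simp_all add: engel_0 engel_Suc)

lemma morse_pair_fun:
  "fst (morse_pair f g k) p = fst (morse_pair (f p) (g p) k) \<and>
   snd (morse_pair f g k) p = snd (morse_pair (f p) (g p) k)"
  by (induction k) (simp_all add: circ_def)

lemma morse_words_Suc:
  "morse_u (Suc (Suc n)) = morse_u (Suc n) @ morse_v (Suc n)"
  "morse_v (Suc (Suc n)) = morse_v (Suc n) @ morse_u (Suc n)"
  by (simp_all add: morse_u_def morse_v_def case_prod_beta Let_def)

text \<open>Distinct first letters make the Morse identity nontrivial.\<close>

lemma hd_morse_words:
  "morse_u (Suc n) \<noteq> [] \<and> hd (morse_u (Suc n)) = 0 \<and> morse_v (Suc n) \<noteq> [] \<and> hd (morse_v (Suc n)) = 1"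
  by (induction n) (simp_all add: morse_words_Suc, simp_all add: morse_u_def morse_v_def)

lemma eval_morse_words:
  "eval_word circ s (morse_u (Suc n)) = fst (morse_pair (s 0) (s 1) n) \<and>
   eval_word circ s (morse_v (Suc n)) = snd (morse_pair (s 0) (s 1) n)"
proof (induction n)
  case 0
  then show ?case by (simp add: morse_u_def morse_v_def)
next
  case (Suc n)
  then show ?case
    unfolding morse_words_Suc using hd_morse_words[of n]
    by (simp add: eval_word_append[of circ, OF circ_assoc])
qed

text \<open>The index \<open>k\<close> in \<open>ex_morse_pair_eq\<close> depends on the two elements. It becomes uniform by
  working with the two projections in the algebra of functions on pairs.\<close>

lemma (in tf_algebra) engel_imp_morse:
  assumes "sat_engel TYPE('r)"
  shows "sat_morse_circle TYPE('r)"
proof -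
  obtain n where n: "n \<ge> 1" "\<And>x y. engel n x y = (0 :: 'r)"
    using assms unfolding sat_engel_def by blast
  interpret F: tf_algebra "fun_sm sm :: 'k \<Rightarrow> ('r \<times> 'r \<Rightarrow> 'r) \<Rightarrow> 'r \<times> 'r \<Rightarrow> 'r"
    by (rule tf_algebra_fun)
  have "engel n f g = (0 :: 'r \<times> 'r \<Rightarrow> 'r)" for f g
    by (simp add: fun_eq_iff engel_fun n(2))
  then obtain k where "fst (morse_pair fst snd k) = (snd (morse_pair fst snd k) :: 'r \<times> 'r \<Rightarrow> 'r)"
    using F.ex_morse_pair_eq n(1) by blast
  then have "fst (morse_pair x y k) = snd (morse_pair x y k)" for x y :: 'r
    using morse_pair_fun[of fst snd k "(x, y)"] by (metis fst_conv snd_conv)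
  then show ?thesis
    unfolding sat_morse_circle_def by (intro exI[of _ "Suc k"]) (simp add: eval_morse_words)
qed

lemma morse_imp_circle:
  assumes "sat_morse_circle TYPE('r::ring)"
  shows "sat_circle_sg_identity TYPE('r)"
proof -
  obtain n where "n \<ge> 1" and n: "\<And>x y::'r. eval_word circ (\<lambda>i. if i = 0 then x else y) (morse_u n) =
      eval_word circ (\<lambda>i. if i = 0 then x else y) (morse_v n)"
    using assms unfolding sat_morse_circle_def by blast
  then obtain m where m: "n = Suc m" by (cases n) auto
  have "eval_word circ s (morse_u n) = eval_word circ s (morse_v n)" for s :: "nat \<Rightarrow> 'r"
    using n[of "s 0" "s 1"] unfolding m by (simp add: eval_morse_words)
  then show ?thesis
    unfolding sat_circle_sg_identity_def sg_identity_def
    using hd_morse_words[of m] m by (intro exI[of _ "morse_u n"] exI[of _ "morse_v n"]) auto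
qed

theorem theorem1p1:
  fixes sm :: "'k::idom \<Rightarrow> 'r::ring \<Rightarrow> 'r"
  assumes "infinite (UNIV :: 'k set)"
    and "kalgebra sm"
    and "torsion_free sm"
  shows "(sat_circle_sg_identity TYPE('r) \<longleftrightarrow> sat_reduced_sg_identity TYPE('r)) \<and>
         (sat_reduced_sg_identity TYPE('r) \<longleftrightarrow> sat_reduced_binomial_identity sm) \<and>
         (sat_reduced_binomial_identity sm \<longleftrightarrow> sat_cond_iv sm) \<and>
         (sat_cond_iv sm \<longleftrightarrow> sat_engel TYPE('r)) \<and>
         (sat_engel TYPE('r) \<longleftrightarrow> sat_morse_circle TYPE('r))"
proof -
  interpret tf_algebra sm by unfold_locales (rule assms)+
  show ?thesis
    using circle_imp_reduced_sg reduced_sg_imp_binomial binomial_imp_iv iv_imp_engel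
      engel_imp_iv engel_imp_morse morse_imp_circle by blast
qed

end
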